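(* For every $n$, the tied braid monoid $TB_n$ is (isomorphic to) the monoid $\mathsf{P}_n\rtimes B_n$.
   Context: $B_n$ is the braid group on $n$ strands with elementary braids $\sigma_1,\dots,\sigma_{n-1}$. $S_n$ is the symmetric group, $s_i=(i,i+1)$, and $\pi:B_n\to S_n$, $\sigma_i\mapsto s_i$, is the natural epimorphism; write $\pi_\alpha=\pi(\alpha)$. $\mathsf{P}_n$ is the set of set partitions of $\{1,\dots,n\}$, ordered by $I\preceq J$ iff each block of $J$ is a union of blocks of $I$. It is a commutative monoid with product $I\ast J$ = the minimal set partition $K$ (for $\preceq$) with $I\preceq K$ and $J\preceq K$, and identity $\{\{1\},\dots,\{n\}\}$. $S_n$ acts on $\mathsf{P}_n$ by $w(\{I_1,\dots,I_m\})=\{w(I_1),\dots,w(I_m)\}$. $\mathsf{P}_n\rtimes B_n$ is the set $\mathsf{P}_n\times B_n$ with multiplication $(I,\alpha)(J,\beta)=(I\ast\pi_\alpha(J),\alpha\beta)$. $TB_n$ is the monoid presented by generators $\sigma_1^{\pm1},\dots,\sigma_{n-1}^{\pm1}$ (with $\sigma_i\sigma_i^{-1}=\sigma_i^{-1}\sigma_i=1$) and $\eta_1,\dots,\eta_{n-1}$, subject to the braid relations among the $\sigma_i$ ($\sigma_i\sigma_j=\sigma_j\sigma_i$ for $|i-j|>1$, $\sigma_i\sigma_{i+1}\sigma_i=\sigma_{i+1}\sigma_i\sigma_{i+1}$) and the relations $\eta_i\eta_j=\eta_j\eta_i$ for all $i,j$; $\eta_i\sigma_i=\sigma_i\eta_i$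 for all $i$; $\eta_i\sigma_j=\sigma_j\eta_i$ for $|i-j|>1$; $\eta_i\sigma_j\sigma_i=\sigma_j\sigma_i\eta_j$ for $|i-j|=1$; $\eta_i\sigma_j\sigma_i^{-1}=\sigma_j\sigma_i^{-1}\eta_j$ for $|i-j|=1$; $\eta_i\eta_j\sigma_i=\eta_j\sigma_i\eta_j=\sigma_i\eta_i\eta_j$ for $|i-j|=1$; $\eta_i\eta_i=\eta_i$ for all $i$. *)

theory Defs
  imports "HOL-Algebra.Sym_Groups" "HOL-Library.Disjoint_Sets"
begin

section \<open>Monoids given by generators and relations\<close>

inductive pres_cong :: "'a set \<Rightarrow> ('a list \<Rightarrow> 'a list \<Rightarrow> bool) \<Rightarrow> 'a list \<Rightarrow> 'a list \<Rightarrow> bool"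
  for A R
  where
    refl: "w \<in> lists A \<Longrightarrow> pres_cong A R w w"
  | sym: "pres_cong A R u v \<Longrightarrow> pres_cong A R v u"
  | trans: "pres_cong A R u v \<Longrightarrow> pres_cong A R v w \<Longrightarrow> pres_cong A R u w"
  | rel: "R u v \<Longrightarrow> x \<in> lists A \<Longrightarrow> y \<in> lists A \<Longrightarrow> pres_cong A R (x @ u @ y) (x @ v @ y)"

definition pres_class :: "'a set \<Rightarrow> ('a list \<Rightarrow> 'a list \<Rightarrow> bool) \<Rightarrow> 'a list \<Rightarrow> 'a list set" where
  "pres_class A R w = {v. pres_cong A R w v}"

definition presented_monoid ::
  "'a set \<Rightarrow> ('a list \<Rightarrow> 'a list \<Rightarrow> bool) \<Rightarrow> 'a list set monoid" where
  "presented_monoid A R =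
    \<lparr>carrier = pres_class A R ` lists A,
     mult = (\<lambda>X Y. \<Union>x\<in>X. \<Union>y\<in>Y. pres_class A R (x @ y)),
     one = pres_class A R []\<rparr>"

locale presentation =
  fixes A :: "'a set" and R :: "'a list \<Rightarrow> 'a list \<Rightarrow> bool"
  assumes rel_words: "R u v \<Longrightarrow> u \<in> lists A \<and> v \<in> lists A"
begin

lemma pres_cong_words: "pres_cong A R u v \<Longrightarrow> u \<in> lists A \<and> v \<in> lists A"
proof (induction rule: pres_cong.induct)
  case (rel u v x y)
  then show ?case using rel_words[of u v] by simp
qed auto

lemma pres_cong_context:
  "pres_cong A R u v \<Longrightarrow> p \<in> lists A \<Longrightarrow> q \<in> lists A \<Longrightarrow> pres_cong A R (p @ u @ q) (p @ v @ q)"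
proof (induction rule: pres_cong.induct)
  case (refl w)
  then show ?case by (intro pres_cong.refl) simp
next
  case (sym u v)
  then show ?case by (blast intro: pres_cong.sym)
next
  case (trans u v w)
  then show ?case by (blast intro: pres_cong.trans)
next
  case (rel u v x y)
  then show ?case using pres_cong.rel[of R u v "p @ x" A "y @ q"] by simp
qed

lemma pres_cong_append:
  assumes "pres_cong A R u u'" "pres_cong A R v v'"
  shows "pres_cong A R (u @ v) (u' @ v')"
proof -
  have "pres_cong A R (u @ v) (u' @ v)"
    using pres_cong_context[OF assms(1), of "[]" v] pres_cong_words[OF assms(2)] by simp
  moreover have "pres_cong A R (u' @ v) (u' @ v')"
    using pres_cong_context[OF assms(2), of u' "[]"] pres_cong_words[OF assms(1)] by simp
  ultimately show ?thesis by (rule pres_cong.trans)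
qed

lemma pres_class_eqI: "pres_cong A R u v \<Longrightarrow> pres_class A R u = pres_class A R v"
  unfolding pres_class_def by (blast intro: pres_cong.sym pres_cong.trans)

lemma pres_class_mult:
  assumes "u \<in> lists A" "v \<in> lists A"
  shows "pres_class A R u \<otimes>\<^bsub>presented_monoid A R\<^esub> pres_class A R v = pres_class A R (u @ v)"
proof -
  have *: "pres_class A R (x @ y) = pres_class A R (u @ v)"
    if "x \<in> pres_class A R u" "y \<in> pres_class A R v" for x y
    using that pres_class_eqI[OF pres_cong_append[of u x v y]] unfolding pres_class_def by simp
  have "u \<in> pres_class A R u" "v \<in> pres_class A R v"
    using assms by (auto simp: pres_class_def intro: pres_cong.refl)
  then have ne: "pres_class A R u \<noteq> {}" "pres_class A R v \<noteq> {}" by auto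
  have "(\<Union>x\<in>pres_class A R u. \<Union>y\<in>pres_class A R v. pres_class A R (x @ y))
      = (\<Union>x\<in>pres_class A R u. \<Union>y\<in>pres_class A R v. pres_class A R (u @ v))"
    by (intro SUP_cong HOL.refl *)
  also have "\<dots> = pres_class A R (u @ v)"
    using ne by simp
  finally show ?thesis by (simp add: presented_monoid_def)
qed

lemma carrier_presented: "carrier (presented_monoid A R) = pres_class A R ` lists A"
  and one_presented: "\<one>\<^bsub>presented_monoid A R\<^esub> = pres_class A R []"
  by (simp_all add: presented_monoid_def)

lemma monoid_presented: "monoid (presented_monoid A R)"
  by (rule monoidI; unfold carrier_presented one_presented; (elim imageE)?;
      simp add: pres_class_mult lists.Nil)

end


section \<open>The braid group and its projection to the symmetric group\<close>

datatype braid_gen = Sig nat | Sig_inv nat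

definition braid_gens :: "nat \<Rightarrow> braid_gen set" where
  "braid_gens n = Sig ` {1..<n} \<union> Sig_inv ` {1..<n}"

inductive braid_rel :: "nat \<Rightarrow> braid_gen list \<Rightarrow> braid_gen list \<Rightarrow> bool" for n where
  inv_right: "i \<in> {1..<n} \<Longrightarrow> braid_rel n [Sig i, Sig_inv i] []"
| inv_left: "i \<in> {1..<n} \<Longrightarrow> braid_rel n [Sig_inv i, Sig i] []"
| far: "i \<in> {1..<n} \<Longrightarrow> j \<in> {1..<n} \<Longrightarrow> \<bar>int i - int j\<bar> > 1 \<Longrightarrow>
    braid_rel n [Sig i, Sig j] [Sig j, Sig i]"
| braid: "i \<in> {1..<n} \<Longrightarrow> i + 1 \<in> {1..<n} \<Longrightarrow>
    braid_rel n [Sig i, Sig (i+1), Sig i] [Sig (i+1), Sig i, Sig (i+1)]"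

text \<open>Because of the first two families of relations, this monoid presentation on the letters
  \<open>\<sigma>\<^sub>i\<close> and \<open>\<sigma>\<^sub>i\<^sup>-\<^sup>1\<close> is Artin's group presentation.\<close>

definition braid_group :: "nat \<Rightarrow> braid_gen list set monoid" where
  "braid_group n = presented_monoid (braid_gens n) (braid_rel n)"

primrec gen_perm :: "braid_gen \<Rightarrow> nat \<Rightarrow> nat" where
  "gen_perm (Sig i) = transpose i (i+1)"
| "gen_perm (Sig_inv i) = inv' (transpose i (i+1))"

definition word_perm :: "braid_gen list \<Rightarrow> nat \<Rightarrow> nat" where
  "word_perm w = foldr (\<lambda>g p. gen_perm g \<circ> p) w id"

text \<open>A braid is a congruence class of words; all words in it have the same permutation.\<close>

definition braid_perm :: "braid_gen list set \<Rightarrow> nat \<Rightarrow> nat" where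
  "braid_perm \<alpha> = the_elem (word_perm ` \<alpha>)"

interpretation braid: presentation "braid_gens n" "braid_rel n" for n
  by unfold_locales (auto simp: braid_gens_def elim!: braid_rel.cases)

lemma word_perm_simps [simp]:
  "word_perm [] = id"
  "word_perm (g # w) = gen_perm g \<circ> word_perm w"
  by (simp_all add: word_perm_def)

lemma word_perm_append [simp]: "word_perm (u @ v) = word_perm u \<circ> word_perm v"
  by (induction u) (simp_all add: comp_assoc)

lemma word_perm_braid_rel: "braid_rel n u v \<Longrightarrow> word_perm u = word_perm v"
  by (induction rule: braid_rel.induct) (auto simp: fun_eq_iff transpose_def)

lemma word_perm_cong: "pres_cong (braid_gens n) (braid_rel n) u v \<Longrightarrow> word_perm u = word_perm v"
  by (induction rule: pres_cong.induct) (auto dest: word_perm_braid_rel)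

lemma braid_perm_class:
  assumes "w \<in> lists (braid_gens n)"
  shows "braid_perm (pres_class (braid_gens n) (braid_rel n) w) = word_perm w"
proof -
  have "word_perm ` pres_class (braid_gens n) (braid_rel n) w = {word_perm w}"
    using pres_cong.refl[OF assms] by (auto simp: pres_class_def dest: word_perm_cong)
  then show ?thesis by (simp add: braid_perm_def)
qed

lemma word_perm_permutes: "w \<in> lists (braid_gens n) \<Longrightarrow> word_perm w permutes {1..n}"
proof (induction w)
  case (Cons g w)
  from Cons.prems have "gen_perm g permutes {1..n}"
    by (auto simp: braid_gens_def intro!: permutes_swap_id)
  moreover have "word_perm w permutes {1..n}"
    using Cons by simp
  ultimately show ?case unfolding word_perm_simps by (intro permutes_compose)
qed (simp add: permutes_id)

lemma group_braid_group: "group (braid_group n)"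
proof -
  let ?G = "braid_group n" and ?c = "pres_class (braid_gens n) (braid_rel n)"
  interpret monoid ?G
    unfolding braid_group_def by (rule braid.monoid_presented)
  have "\<exists>v \<in> lists (braid_gens n). ?c v \<otimes>\<^bsub>?G\<^esub> ?c w = \<one>\<^bsub>?G\<^esub>" if "w \<in> lists (braid_gens n)" for w
    using that
  proof (induction w)
    case Nil
    have "?c [] \<otimes>\<^bsub>?G\<^esub> ?c [] = \<one>\<^bsub>?G\<^esub>"
      by (simp add: braid_group_def braid.pres_class_mult braid.one_presented)
    then show ?case by auto
  next
    case (Cons g w)
    then have w: "w \<in> lists (braid_gens n)" by simp
    with Cons.IH obtain v where v: "v \<in> lists (braid_gens n)" "?c v \<otimes>\<^bsub>?G\<^esub> ?c w = \<one>\<^bsub>?G\<^esub>" by blast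
    obtain h where h: "h \<in> braid_gens n" "braid_rel n [h, g] []"
    proof -
      from Cons.hyps consider i where "i \<in> {1..<n}" "g = Sig i" | i where "i \<in> {1..<n}" "g = Sig_inv i"
        unfolding braid_gens_def by blast
      then show ?thesis
      proof cases
        case 1
        then show ?thesis
          using that[of "Sig_inv i"] braid_rel.inv_left[of i n] by (auto simp: braid_gens_def)
      next
        case 2
        then show ?thesis
          using that[of "Sig i"] braid_rel.inv_right[of i n] by (auto simp: braid_gens_def)
      qed
    qed
    from h v(1) Cons.hyps have "?c ((v @ [h]) @ (g # w)) = ?c (v @ w)"
      using pres_cong.rel[of "braid_rel n" "[h, g]" "[]" v "braid_gens n" w]
      by (intro braid.pres_class_eqI) simp
    then have "?c (v @ [h]) \<otimes>\<^bsub>?G\<^esub> ?c (g # w) = \<one>\<^bsub>?G\<^esub>"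
      using v h Cons.hyps by (simp add: braid_group_def braid.pres_class_mult)
    moreover have "v @ [h] \<in> lists (braid_gens n)"
      using v h by simp
    ultimately show ?case by blast
  qed
  then have "\<exists>y \<in> carrier ?G. y \<otimes>\<^bsub>?G\<^esub> x = \<one>\<^bsub>?G\<^esub>" if "x \<in> carrier ?G" for x
    using that by (auto simp: braid_group_def braid.carrier_presented)
  then show ?thesis
    by (intro groupI) (auto simp: m_assoc)
qed

lemma braid_perm_hom: "braid_perm \<in> hom (braid_group n) (sym_group n)"
proof (rule homI)
  fix \<alpha> \<beta> assume "\<alpha> \<in> carrier (braid_group n)" "\<beta> \<in> carrier (braid_group n)"
  then show "braid_perm (\<alpha> \<otimes>\<^bsub>braid_group n\<^esub> \<beta>) = braid_perm \<alpha> \<otimes>\<^bsub>sym_group n\<^esub> braid_perm \<beta>"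
    unfolding braid_group_def braid.carrier_presented
    by (elim imageE) (simp add: braid.pres_class_mult braid_perm_class sym_group_mult)
next
  fix \<alpha> assume "\<alpha> \<in> carrier (braid_group n)"
  then show "braid_perm \<alpha> \<in> carrier (sym_group n)"
    unfolding braid_group_def braid.carrier_presented
    by (elim imageE) (simp only: braid_perm_class sym_group_carrier word_perm_permutes)
qed

lemma braid_perm_Sig:
  "i \<in> {1..<n} \<Longrightarrow>
    braid_perm (pres_class (braid_gens n) (braid_rel n) [Sig i]) = transpose i (i+1)"
  by (subst braid_perm_class) (auto simp: braid_gens_def)


section \<open>The monoid of set partitions\<close>

definition partition_le :: "'a set set \<Rightarrow> 'a set set \<Rightarrow> bool" (infix \<open>\<preceq>\<close> 50) where
  "I \<preceq> J \<longleftrightarrow> (\<forall>B\<in>J. \<exists>S\<subseteq>I. B = \<Union>S)"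

definition is_partition_join ::
  "'a set \<Rightarrow> 'a set set \<Rightarrow> 'a set set \<Rightarrow> 'a set set \<Rightarrow> bool" where
  "is_partition_join A I J K \<longleftrightarrow> partition_on A K \<and> I \<preceq> K \<and> J \<preceq> K \<and>
    (\<forall>L. partition_on A L \<and> I \<preceq> L \<and> J \<preceq> L \<longrightarrow> K \<preceq> L)"

definition partition_join :: "'a set \<Rightarrow> 'a set set \<Rightarrow> 'a set set \<Rightarrow> 'a set set" where
  "partition_join A I J = (THE K. is_partition_join A I J K)"

definition set_partition_monoid :: "nat \<Rightarrow> nat set set monoid" where
  "set_partition_monoid n =
    \<lparr>carrier = {I. partition_on {1..n} I},
     mult = partition_join {1..n},
     one = (\<lambda>i. {i}) ` {1..n}\<rparr>"

definition partition_act :: "('a \<Rightarrow> 'a) \<Rightarrow> 'a set set \<Rightarrow> 'a set set" where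
  "partition_act w I = (\<lambda>B. w ` B) ` I"

lemma partition_leI:
  assumes "\<And>B x. B \<in> J \<Longrightarrow> x \<in> B \<Longrightarrow> \<exists>X\<in>I. x \<in> X \<and> X \<subseteq> B"
  shows "I \<preceq> J"
  unfolding partition_le_def
proof
  fix B assume "B \<in> J"
  then have "\<Union>{X \<in> I. X \<subseteq> B} = B" using assms by blast
  then show "\<exists>S\<subseteq>I. B = \<Union>S" by (metis (lifting) mem_Collect_eq subsetI)
qed

lemma partition_le_refl: "I \<preceq> I"
  by (rule partition_leI) blast

lemma partition_leE:
  assumes "I \<preceq> J" "B \<in> J" "x \<in> B"
  obtains X where "X \<in> I" "x \<in> X" "X \<subseteq> B"
  using assms unfolding partition_le_def by (metis Union_iff Union_upper subsetD)

lemma partition_le_trans: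
  assumes "I \<preceq> J" "J \<preceq> K"
  shows "I \<preceq> K"
proof (rule partition_leI)
  fix B x assume "B \<in> K" "x \<in> B"
  with assms(2) obtain C where C: "C \<in> J" "x \<in> C" "C \<subseteq> B" by (rule partition_leE)
  with assms(1) obtain X where "X \<in> I" "x \<in> X" "X \<subseteq> C" by (meson partition_leE)
  with C show "\<exists>X\<in>I. x \<in> X \<and> X \<subseteq> B" by blast
qed

lemma partition_le_antisym:
  assumes I: "partition_on A I" and J: "partition_on A J" and "I \<preceq> J" "J \<preceq> I"
  shows "I = J"
proof -
  have *: "Q \<subseteq> P" if P: "partition_on A P" and Q: "partition_on A Q" and "P \<preceq> Q" "Q \<preceq> P" for P Q
  proof
    fix B assume B: "B \<in> Q"
    with Q have "B \<noteq> {}" by (auto dest: partition_onD3)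
    then obtain b where "b \<in> B" by blast
    with \<open>P \<preceq> Q\<close> B obtain X where X: "X \<in> P" "b \<in> X" "X \<subseteq> B" by (meson partition_leE)
    with \<open>Q \<preceq> P\<close> obtain C where C: "C \<in> Q" "C \<subseteq> X" by (meson partition_leE)
    with Q have "C \<noteq> {}" by (auto dest: partition_onD3)
    with C X B partition_onD2[OF Q] have "C = B"
      unfolding disjoint_def by blast
    with C X show "B \<in> P" by auto
  qed
  show ?thesis using *[OF I J] *[OF J I] assms by auto
qed

lemma ex_partition_join:
  assumes I: "partition_on A I" and J: "partition_on A J"
  shows "\<exists>K. is_partition_join A I J K"
proof -
  define U where "U P = {S. \<exists>T\<subseteq>P. S = \<Union>T}" for P :: "'a set set"
  define E where "E = {(x, y). x \<in> A \<and> y \<in> A \<and> (\<forall>S \<in> U I \<inter> U J. x \<in> S \<longleftrightarrow> y \<in> S)}"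
  have E: "equiv A E"
    by (rule equivI) (auto simp: E_def refl_on_def sym_def trans_def)
  have below: "P \<preceq> A // E" if P: "partition_on A P" "P = I \<or> P = J" for P
  proof (rule partition_leI)
    fix B x assume B: "B \<in> A // E" and x: "x \<in> B"
    then have "x \<in> A" using E in_quotient_imp_subset by blast
    then obtain X where X: "X \<in> P" "x \<in> X" using partition_onD1[OF P(1)] by blast
    have "(x, y) \<in> E" if y: "y \<in> X" for y
    proof -
      have "x \<in> S \<longleftrightarrow> y \<in> S" if "S \<in> U I \<inter> U J" for S
      proof -
        from that P(2) obtain T where T: "T \<subseteq> P" "S = \<Union>T" by (auto simp: U_def)
        have "Z = X" if "Z \<in> T" "x \<in> Z \<or> y \<in> Z" for Z
          using that T X y partition_onD2[OF P(1)] unfolding disjoint_def by blast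
        with T X y show ?thesis by blast
      qed
      moreover have "y \<in> A" using X y partition_onD1[OF P(1)] by blast
      ultimately show ?thesis using \<open>x \<in> A\<close> by (simp add: E_def)
    qed
    then have "X \<subseteq> B" using in_quotient_imp_closed[OF E B x] by blast
    with X show "\<exists>X\<in>P. x \<in> X \<and> X \<subseteq> B" by blast
  qed
  have least: "A // E \<preceq> L" if L: "partition_on A L" "I \<preceq> L" "J \<preceq> L" for L
  proof (rule partition_leI)
    fix B x assume B: "B \<in> L" and x: "x \<in> B"
    with L have BU: "B \<in> U I \<inter> U J" by (auto simp: U_def partition_le_def)
    have "x \<in> A" using B x partition_onD1[OF L(1)] by blast
    then have "E `` {x} \<in> A // E" "x \<in> E `` {x}" "E `` {x} \<subseteq> B"
      using BU x by (auto simp: E_def quotient_def)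
    then show "\<exists>X\<in>A // E. x \<in> X \<and> X \<subseteq> B" by blast
  qed
  have "is_partition_join A I J (A // E)"
    unfolding is_partition_join_def using partition_on_quotient[OF E] below I J least by blast
  then show ?thesis ..
qed

lemma is_partition_join_unique:
  "is_partition_join A I J K \<Longrightarrow> is_partition_join A I J L \<Longrightarrow> K = L"
  unfolding is_partition_join_def by (rule partition_le_antisym[of A]) simp_all

lemma partition_join_eqI: "is_partition_join A I J K \<Longrightarrow> partition_join A I J = K"
  unfolding partition_join_def by (rule the_equality) (auto dest: is_partition_join_unique)

lemma is_partition_join_partition_join:
  "partition_on A I \<Longrightarrow> partition_on A J \<Longrightarrow> is_partition_join A I J (partition_join A I J)"
  using ex_partition_join[of A I J] partition_join_eqI[of A I J] by auto

lemma comm_monoid_set_partition_monoid: "comm_monoid (set_partition_monoid n)"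
proof (rule comm_monoidI, goal_cases)
  case (1 x y)
  then show ?case
    using is_partition_join_partition_join[of "{1..n}" x y]
    by (simp add: set_partition_monoid_def is_partition_join_def)
next
  case 2
  then show ?case
    by (simp add: set_partition_monoid_def partition_on_singletons)
next
  case (3 x y z)
  let ?j = "partition_join {1..n}"
  from 3 have p: "partition_on {1..n} x" "partition_on {1..n} y" "partition_on {1..n} z"
    by (simp_all add: set_partition_monoid_def)
  note xy = is_partition_join_partition_join[OF p(1,2)]
    and yz = is_partition_join_partition_join[OF p(2,3)]
  have q: "partition_on {1..n} (?j x y)" "partition_on {1..n} (?j y z)"
    using xy yz by (simp_all add: is_partition_join_def)
  have "is_partition_join {1..n} (?j x y) z (?j x (?j y z))"
    using is_partition_join_partition_join[OF p(1) q(2)] xy yz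
    unfolding is_partition_join_def by (meson partition_le_trans)
  then show ?case
    by (simp add: set_partition_monoid_def partition_join_eqI)
next
  case (4 x)
  then have x: "partition_on {1..n} x" by (simp add: set_partition_monoid_def)
  have "(\<lambda>i. {i}) ` {1..n} \<preceq> x"
    using partition_onD1[OF x] by (intro partition_leI) blast
  then have "is_partition_join {1..n} ((\<lambda>i. {i}) ` {1..n}) x x"
    using x by (simp add: is_partition_join_def partition_le_refl)
  then show ?case
    by (simp add: set_partition_monoid_def partition_join_eqI)
next
  case (5 x y)
  have "is_partition_join {1..n} x y = is_partition_join {1..n} y x"
    by (auto simp: is_partition_join_def fun_eq_iff)
  then show ?case
    by (simp add: set_partition_monoid_def partition_join_def)
qed

lemma partition_act_comp: "partition_act (v \<circ> w) I = partition_act v (partition_act w I)"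
  by (simp add: partition_act_def image_image image_comp)

lemma partition_act_id [simp]: "partition_act id I = I"
  by (simp add: partition_act_def)

lemma partition_on_partition_act:
  assumes "w permutes A" "partition_on A I"
  shows "partition_on A (partition_act w I)"
proof -
  have "partition_on (w ` A) ((`) w ` I - {{}})"
    using assms by (intro partition_on_inj_image) (auto intro: permutes_inj_on)
  moreover have "{} \<notin> (`) w ` I"
    using partition_onD3[OF assms(2)] by auto
  ultimately show ?thesis
    using assms(1) by (simp add: partition_act_def permutes_image)
qed

lemma partition_act_mono:
  assumes "I \<preceq> J"
  shows "partition_act w I \<preceq> partition_act w J"
proof (rule partition_leI)
  fix B x assume "B \<in> partition_act w J" "x \<in> B"
  then obtain C y where C: "C \<in> J" "B = w ` C" "y \<in> C" "x = w y"
    by (auto simp: partition_act_def)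
  with assms obtain X where "X \<in> I" "y \<in> X" "X \<subseteq> C" by (meson partition_leE)
  with C show "\<exists>X\<in>partition_act w I. x \<in> X \<and> X \<subseteq> B" by (auto simp: partition_act_def)
qed

lemma partition_act_join:
  assumes w: "w permutes A" and I: "partition_on A I" and J: "partition_on A J"
  shows "partition_act w (partition_join A I J)
    = partition_join A (partition_act w I) (partition_act w J)"
proof -
  let ?K = "partition_join A I J" and ?v = "inv' w"
  have v: "?v permutes A" using w by (rule permutes_inv)
  have vw: "partition_act ?v (partition_act w X) = X" "partition_act w (partition_act ?v X) = X" for X
    using w by (simp_all add: partition_act_comp[symmetric] permutes_inv_o)
  have K: "is_partition_join A I J ?K"
    using I J by (rule is_partition_join_partition_join)
  have "partition_act w ?K \<preceq> L"
    if "partition_on A L" "partition_act w I \<preceq> L" "partition_act w J \<preceq> L" for L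
  proof -
    have "I \<preceq> partition_act ?v L" "J \<preceq> partition_act ?v L"
      using that(2,3)[THEN partition_act_mono, of ?v] by (simp_all add: vw)
    then have "?K \<preceq> partition_act ?v L"
      using K that(1) v partition_on_partition_act unfolding is_partition_join_def by blast
    then show ?thesis
      using partition_act_mono[of ?K _ w] vw(2) by metis
  qed
  then have "is_partition_join A (partition_act w I) (partition_act w J) (partition_act w ?K)"
    using K w unfolding is_partition_join_def
    by (simp add: partition_act_mono partition_on_partition_act)
  then show ?thesis by (rule partition_join_eqI[symmetric])
qed


section \<open>The semidirect product of set partitions and braids\<close>

definition partition_braid_monoid :: "nat \<Rightarrow> (nat set set \<times> braid_gen list set) monoid" where
  "partition_braid_monoid n =
    \<lparr>carrier = carrier (set_partition_monoid n) \<times> carrier (braid_group n),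
     mult = (\<lambda>(I, \<alpha>) (J, \<beta>).
       (I \<otimes>\<^bsub>set_partition_monoid n\<^esub> partition_act (braid_perm \<alpha>) J, \<alpha> \<otimes>\<^bsub>braid_group n\<^esub> \<beta>)),
     one = (\<one>\<^bsub>set_partition_monoid n\<^esub>, \<one>\<^bsub>braid_group n\<^esub>)\<rparr>"

lemma monoid_partition_braid_monoid: "monoid (partition_braid_monoid n)"
proof -
  interpret P: comm_monoid "set_partition_monoid n" by (rule comm_monoid_set_partition_monoid)
  interpret B: group "braid_group n" by (rule group_braid_group)
  have perm: "braid_perm \<alpha> permutes {1..n}" if "\<alpha> \<in> carrier (braid_group n)" for \<alpha>
    using hom_in_carrier[OF braid_perm_hom that] by (simp add: sym_group_carrier)
  have mult: "braid_perm (\<alpha> \<otimes>\<^bsub>braid_group n\<^esub> \<beta>) = braid_perm \<alpha> \<circ> braid_perm \<beta>"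
    if "\<alpha> \<in> carrier (braid_group n)" "\<beta> \<in> carrier (braid_group n)" for \<alpha> \<beta>
    using hom_mult[OF braid_perm_hom that] by (simp add: sym_group_mult)
  have one: "braid_perm \<one>\<^bsub>braid_group n\<^esub> = id"
    by (simp add: braid_group_def braid.one_presented braid_perm_class)
  have act: "partition_act (braid_perm \<alpha>) I \<in> carrier (set_partition_monoid n)"
    if "\<alpha> \<in> carrier (braid_group n)" "I \<in> carrier (set_partition_monoid n)" for \<alpha> I
    using that partition_on_partition_act[OF perm] by (simp add: set_partition_monoid_def)
  have act_mult: "partition_act (braid_perm \<alpha>) (I \<otimes>\<^bsub>set_partition_monoid n\<^esub> J)
      = partition_act (braid_perm \<alpha>) I \<otimes>\<^bsub>set_partition_monoid n\<^esub> partition_act (braid_perm \<alpha>) J"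
    if "\<alpha> \<in> carrier (braid_group n)" "I \<in> carrier (set_partition_monoid n)"
      "J \<in> carrier (set_partition_monoid n)" for \<alpha> I J
    using that partition_act_join[OF perm] by (simp add: set_partition_monoid_def)
  have act_one: "partition_act (braid_perm \<alpha>) \<one>\<^bsub>set_partition_monoid n\<^esub> = \<one>\<^bsub>set_partition_monoid n\<^esub>"
    if "\<alpha> \<in> carrier (braid_group n)" for \<alpha>
  proof -
    have "(\<lambda>i. {i}) ` braid_perm \<alpha> ` {1..n} = (\<lambda>i. {i}) ` {1..n}"
      using perm[OF that] by (simp only: permutes_image)
    then show ?thesis
      by (simp add: set_partition_monoid_def partition_act_def image_image)
  qed
  show ?thesis
    by (rule monoidI)
      (auto simp: partition_braid_monoid_def act act_mult act_one mult one partition_act_comp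
        P.m_assoc B.m_assoc)
qed


section \<open>The tied braid monoid\<close>

datatype tied_gen = Braid braid_gen | Eta nat

abbreviation (input) T_Sig :: "nat \<Rightarrow> tied_gen" (\<open>\<sigma>\<close>) where "\<sigma> i \<equiv> Braid (Sig i)"
abbreviation (input) T_Sig_inv :: "nat \<Rightarrow> tied_gen" (\<open>\<sigma>''\<close>) where "\<sigma>' i \<equiv> Braid (Sig_inv i)"
abbreviation (input) T_Eta :: "nat \<Rightarrow> tied_gen" (\<open>\<eta>\<close>) where "\<eta> i \<equiv> Eta i"

definition tied_gens :: "nat \<Rightarrow> tied_gen set" where
  "tied_gens n = Braid ` braid_gens n \<union> Eta ` {1..<n}"

inductive tied_rel :: "nat \<Rightarrow> tied_gen list \<Rightarrow> tied_gen list \<Rightarrow> bool" for n where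
  braid: "braid_rel n u v \<Longrightarrow> tied_rel n (map Braid u) (map Braid v)"
| eta_comm: "i \<in> {1..<n} \<Longrightarrow> j \<in> {1..<n} \<Longrightarrow> tied_rel n [\<eta> i, \<eta> j] [\<eta> j, \<eta> i]"
| eta_sigma: "i \<in> {1..<n} \<Longrightarrow> tied_rel n [\<eta> i, \<sigma> i] [\<sigma> i, \<eta> i]"
| eta_sigma_far: "i \<in> {1..<n} \<Longrightarrow> j \<in> {1..<n} \<Longrightarrow> \<bar>int i - int j\<bar> > 1 \<Longrightarrow>
    tied_rel n [\<eta> i, \<sigma> j] [\<sigma> j, \<eta> i]"
| slide: "i \<in> {1..<n} \<Longrightarrow> j \<in> {1..<n} \<Longrightarrow> \<bar>int i - int j\<bar> = 1 \<Longrightarrow>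
    tied_rel n [\<eta> i, \<sigma> j, \<sigma> i] [\<sigma> j, \<sigma> i, \<eta> j]"
| slide_inv: "i \<in> {1..<n} \<Longrightarrow> j \<in> {1..<n} \<Longrightarrow> \<bar>int i - int j\<bar> = 1 \<Longrightarrow>
    tied_rel n [\<eta> i, \<sigma> j, \<sigma>' i] [\<sigma> j, \<sigma>' i, \<eta> j]"
| eta_eta_sigma1: "i \<in> {1..<n} \<Longrightarrow> j \<in> {1..<n} \<Longrightarrow> \<bar>int i - int j\<bar> = 1 \<Longrightarrow>
    tied_rel n [\<eta> i, \<eta> j, \<sigma> i] [\<eta> j, \<sigma> i, \<eta> j]"
| eta_eta_sigma2: "i \<in> {1..<n} \<Longrightarrow> j \<in> {1..<n} \<Longrightarrow> \<bar>int i - int j\<bar> = 1 \<Longrightarrow>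
    tied_rel n [\<eta> j, \<sigma> i, \<eta> j] [\<sigma> i, \<eta> i, \<eta> j]"
| eta_idem: "i \<in> {1..<n} \<Longrightarrow> tied_rel n [\<eta> i, \<eta> i] [\<eta> i]"

definition tied_braid_monoid :: "nat \<Rightarrow> tied_gen list set monoid" where
  "tied_braid_monoid n = presented_monoid (tied_gens n) (tied_rel n)"

interpretation tied: presentation "tied_gens n" "tied_rel n" for n
proof
  fix u v assume "tied_rel n u v"
  then show "u \<in> lists (tied_gens n) \<and> v \<in> lists (tied_gens n)"
  proof cases
    case (braid u' v')
    then show ?thesis
      using braid.rel_words[OF braid(3)] by (auto simp: tied_gens_def)
  qed (auto simp: tied_gens_def braid_gens_def)
qed

lemma monoid_tied_braid_monoid: "monoid (tied_braid_monoid n)"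
  unfolding tied_braid_monoid_def by (rule tied.monoid_presented)

end

theory Submission
  imports Defs
begin

text \<open>
  Write \<open>\<eta>\<^sub>a\<^sub>b\<close> for the conjugate of \<open>\<eta>\<^sub>a\<close> by \<open>\<sigma>\<^sub>b\<^sub>-\<^sub>1 \<cdots> \<sigma>\<^sub>a\<^sub>+\<^sub>1\<close> in the tied braid monoid. Conjugation by a braid
  \<open>\<alpha>\<close> permutes these elements through \<open>\<pi>\<^sub>\<alpha>\<close>, so the defining relations spread over all pairs of
  strands: the \<open>\<eta>\<^sub>a\<^sub>b\<close> are commuting idempotents with \<open>\<eta>\<^sub>a\<^sub>b \<eta>\<^sub>b\<^sub>d = \<eta>\<^sub>b\<^sub>d \<eta>\<^sub>a\<^sub>d\<close>. Hence every element is a product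
  \<open>p \<alpha>\<close> of some \<open>\<eta>\<^sub>a\<^sub>b\<close> followed by a braid. The pairs with \<open>p \<eta>\<^sub>a\<^sub>b = p\<close> form an equivalence relation on
  the strands, so \<open>p\<close> depends only on the set partition that its factors generate. The homomorphism
  sending \<open>\<eta>\<^sub>i\<close> to the partition tying \<open>i\<close> and \<open>i + 1\<close> therefore separates the normal forms.
\<close>

section \<open>Conjugation by units\<close>

context monoid
begin

definition conjugate_by :: "'a \<Rightarrow> 'a \<Rightarrow> 'a" where
  "conjugate_by u x = u \<otimes> x \<otimes> inv u"

lemma conjugate_by_closed [simp, intro]:
  "u \<in> Units G \<Longrightarrow> x \<in> carrier G \<Longrightarrow> conjugate_by u x \<in> carrier G"
  by (simp add: conjugate_by_def Units_closed)

lemma conjugate_by_one [simp]: "x \<in> carrier G \<Longrightarrow> conjugate_by \<one> x = x"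
  by (simp add: conjugate_by_def)

text \<open>The commutation and slide relations have the shape
  \<open>y \<otimes> u = u \<otimes> x\<close> with \<open>u\<close> a product of braid letters.
  This turns them into statements about the action by conjugation.\<close>

lemma conjugate_by_eq_iff:
  assumes u: "u \<in> Units G" and x: "x \<in> carrier G" and y: "y \<in> carrier G"
  shows "conjugate_by u x = y \<longleftrightarrow> y \<otimes> u = u \<otimes> x"
proof
  assume "conjugate_by u x = y"
  then show "y \<otimes> u = u \<otimes> x"
    using u x by (auto simp: conjugate_by_def m_assoc Units_closed)
next
  assume "y \<otimes> u = u \<otimes> x"
  then have "conjugate_by u x = y \<otimes> u \<otimes> inv u" by (simp add: conjugate_by_def)
  then show "conjugate_by u x = y"
    using u y by (simp add: m_assoc Units_closed)
qed

lemma conjugate_by_commute: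
  "u \<in> Units G \<Longrightarrow> x \<in> carrier G \<Longrightarrow> conjugate_by u x \<otimes> u = u \<otimes> x"
  using conjugate_by_eq_iff by blast

lemma inv_mult_Units:
  assumes "u \<in> Units G" "v \<in> Units G"
  shows "inv (u \<otimes> v) = inv v \<otimes> inv u"
proof (rule inv_unique'[symmetric])
  have "u \<otimes> v \<otimes> (inv v \<otimes> inv u) = u \<otimes> (v \<otimes> inv v) \<otimes> inv u"
    using assms by (simp add: m_assoc Units_closed del: Units_r_inv)
  then show "u \<otimes> v \<otimes> (inv v \<otimes> inv u) = \<one>"
    using assms by (simp add: Units_closed)
  have "inv v \<otimes> inv u \<otimes> (u \<otimes> v) = inv v \<otimes> (inv u \<otimes> u) \<otimes> v"
    using assms by (simp add: m_assoc Units_closed del: Units_l_inv)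
  then show "inv v \<otimes> inv u \<otimes> (u \<otimes> v) = \<one>"
    using assms by (simp add: Units_closed)
qed (use assms in \<open>auto simp: Units_closed\<close>)

lemma conjugate_by_comp:
  assumes "u \<in> Units G" "v \<in> Units G" "x \<in> carrier G"
  shows "conjugate_by (u \<otimes> v) x = conjugate_by u (conjugate_by v x)"
  using assms by (simp add: conjugate_by_def m_assoc inv_mult_Units Units_closed)

lemma conjugate_by_mult:
  assumes u: "u \<in> Units G" and x: "x \<in> carrier G" and y: "y \<in> carrier G"
  shows "conjugate_by u (x \<otimes> y) = conjugate_by u x \<otimes> conjugate_by u y"
proof -
  have "inv u \<otimes> (u \<otimes> (y \<otimes> inv u)) = y \<otimes> inv u"
    using u y by (simp add: m_assoc[symmetric] Units_closed)
  then show ?thesis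
    using assms by (simp add: conjugate_by_def m_assoc Units_closed)
qed

lemma conjugate_by_unit_one [simp]: "u \<in> Units G \<Longrightarrow> conjugate_by u \<one> = \<one>"
  by (simp add: conjugate_by_def Units_closed)

lemma conjugate_by_inv_cancel:
  assumes "u \<in> Units G" "x \<in> carrier G"
  shows "conjugate_by (inv u) (conjugate_by u x) = x" "conjugate_by u (conjugate_by (inv u) x) = x"
  using assms by (simp_all flip: conjugate_by_comp)

end


section \<open>Families indexed by pairs of strands\<close>

text \<open>For \<open>a < b\<close> this applies \<open>c (a+1)\<close>, ...,
  \<open>c (b-1)\<close> in this order to \<open>h a\<close>. The guard \<open>b \<le> a\<close>
  starts the recursion at second index \<open>a + 1\<close>; for smaller second indices
  \<open>h a\<close> is a mere default.\<close>

fun strand_pair :: "(nat \<Rightarrow> 'x \<Rightarrow> 'x) \<Rightarrow> (nat \<Rightarrow> 'x) \<Rightarrow> nat \<Rightarrow> nat \<Rightarrow> 'x" where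
  "strand_pair c h a 0 = h a"
| "strand_pair c h a (Suc b) = (if b \<le> a then h a else c b (strand_pair c h a b))"

text \<open>Abstracts conjugation by the \<sigma>_i acting on the \<eta>_i. Besides the braid
  relations of the maps \<open>c i\<close>, the last three assumptions condense the slide
  relations.\<close>

locale braid_action =
  fixes n :: nat and X :: "'x set" and c :: "nat \<Rightarrow> 'x \<Rightarrow> 'x" and h :: "nat \<Rightarrow> 'x"
  assumes h_in: "i \<in> {1..<n} \<Longrightarrow> h i \<in> X"
    and c_in: "i \<in> {1..<n} \<Longrightarrow> x \<in> X \<Longrightarrow> c i x \<in> X"
    and c_far: "i \<in> {1..<n} \<Longrightarrow> j \<in> {1..<n} \<Longrightarrow> i + 1 < j \<Longrightarrow> x \<in> X \<Longrightarrow> c i (c j x) = c j (c i x)"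
    and c_braid: "i \<in> {1..<n} \<Longrightarrow> i + 1 \<in> {1..<n} \<Longrightarrow> x \<in> X \<Longrightarrow>
      c i (c (i+1) (c i x)) = c (i+1) (c i (c (i+1) x))"
    and c_h_same: "i \<in> {1..<n} \<Longrightarrow> c i (h i) = h i"
    and c_h_far: "i \<in> {1..<n} \<Longrightarrow> j \<in> {1..<n} \<Longrightarrow> \<bar>int i - int j\<bar> > 1 \<Longrightarrow> c j (h i) = h i"
    and c_h_swap: "i \<in> {1..<n} \<Longrightarrow> i + 1 \<in> {1..<n} \<Longrightarrow> c i (h (i+1)) = c (i+1) (h i)"
    and c_c_h_up: "i \<in> {1..<n} \<Longrightarrow> i + 1 \<in> {1..<n} \<Longrightarrow> c i (c (i+1) (h i)) = h (i+1)"
    and c_c_h_down: "i \<in> {1..<n} \<Longrightarrow> i + 1 \<in> {1..<n} \<Longrightarrow> c (i+1) (c i (h (i+1))) = h i"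
begin

abbreviation "E \<equiv> strand_pair c h"

lemma strand_pair_next: "a < b \<Longrightarrow> E a (Suc b) = c b (E a b)"
  by simp

lemma strand_pair_adjacent [simp]: "E a (Suc a) = h a"
  by simp

lemma strand_pair_in: "1 \<le> a \<Longrightarrow> a < b \<Longrightarrow> b \<le> n \<Longrightarrow> E a b \<in> X"
proof (induction b)
  case (Suc b)
  then show ?case
    by (cases "a < b") (auto intro!: h_in c_in)
qed simp

declare strand_pair.simps(2) [simp del]

text \<open>The pair \<open>(k, k+1)\<close> is exceptional because the transposition reverses it,
  while \<open>E\<close> has its meaning only for increasing indices. Induction on
  \<open>b - a\<close> strips the outermost operator \<open>c m\<close> with
  \<open>m = b - 1\<close>; the position of \<open>k\<close> decides which relation applies.\<close>

lemma strand_pair_equivariant: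
  assumes "1 \<le> a" "a < b" "b \<le> n" "k \<in> {1..<n}"
  shows "c k (E a b) = (if k = a \<and> b = Suc a then E a b
    else E (transpose k (k+1) a) (transpose k (k+1) b))"
  using assms
proof (induction "b - a" arbitrary: a b k rule: less_induct)
  case less
  note ih = less.hyps and pre = less.prems
  show ?case
  proof (cases "b = Suc a")
    case True
    consider "k = a" | "k = Suc a" | "Suc k = a" | "\<bar>int a - int k\<bar> > 1" by linarith
    then show ?thesis
    proof cases
      case 1 then show ?thesis using True pre c_h_same by simp
    next
      case 2 then show ?thesis using True pre by (simp add: strand_pair_next transpose_def)
    next
      case 3
      then have "c k (h (k+1)) = c (k+1) (h k)" using pre True c_h_swap[of k] by auto
      then show ?thesis using True pre 3
        by (auto simp: strand_pair_next transpose_def)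
    next
      case 4 then show ?thesis using True pre c_h_far[of a k]
        by (auto simp: transpose_def)
    qed
  next
    case False
    with pre obtain m where b: "b = Suc m" and am: "a < m" by (cases b) auto
    have Eb: "E a b = c m (E a m)" using am b by (simp add: strand_pair_next)
    have Em: "E a m \<in> X" using pre am b by (intro strand_pair_in) auto
    consider "k > b" | "k = b" | "k = m" | "Suc k = m" | "Suc k < m" using b by linarith
    then show ?thesis
    proof cases
      \<comment> \<open>Above \<open>b\<close>, \<open>c k\<close> commutes with \<open>c m\<close>
        and fixes \<open>E a m\<close> by induction.\<close>
      case 1
      then have "c k (E a m) = E a m"
        using ih[of m a k] pre am b by (auto simp: transpose_def)
      then show ?thesis
        using c_far[of m k "E a m"] Em Eb pre 1 am b by (auto simp: transpose_def)
    next
      case 2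
      then show ?thesis using pre by (auto simp: transpose_def strand_pair_next)
    next
      case k: 3
      \<comment> \<open>Since \<open>E a b = c m (E a m)\<close>, the claim is that applying
        \<open>c m\<close> twice fixes \<open>E a m\<close>.\<close>
      show ?thesis
      proof (cases "m = Suc a")
        case True
        have "c m (c m (h a)) = c (a+1) (c a (h (a+1)))"
          using True pre b c_h_swap[of a] by auto
        also have "\<dots> = h a" using True pre b c_c_h_down[of a] by auto
        finally show ?thesis using True k Eb b by (simp add: transpose_def)
      next
        case False
        then have sm: "Suc a < m" using am by simp
        \<comment> \<open>Write \<open>E a m\<close> as \<open>c a\<close> of the pair with its
          lower strand raised. As \<open>a + 1 < m\<close>, \<open>c a\<close> commutes with
          \<open>c m\<close>, and the induction hypothesis covers the shorter pairs
          \<open>(a+1, m)\<close> and \<open>(a+1, b)\<close>.\<close>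
        define y where "y = E (Suc a) m"
        have y: "y \<in> X" unfolding y_def using sm pre b by (intro strand_pair_in) auto
        have a: "a \<in> {1..<n}" and m: "m \<in> {1..<n}" using pre am b by auto
        have 1: "E a m = c a y"
          unfolding y_def using ih[of m "Suc a" a] sm pre b by (auto simp: transpose_def)
        have 2: "c m (c m y) = y"
          unfolding y_def using ih[of b "Suc a" m] sm pre b
          by (auto simp: transpose_def strand_pair_next)
        have "c m (c m (c a y)) = c a (c m (c m y))"
          using c_far[of a m y] c_far[of a m "c m y"] c_in[of m y] a m y sm by simp
        then have "c m (c m (E a m)) = E a m" using 1 2 by simp
        then show ?thesis using k Eb b am by (auto simp: transpose_def)
      qed
    next
      case k: 4
      show ?thesis
      proof (cases "a = k")
        case True
        then show ?thesis using k Eb b pre c_c_h_up[of a] by (auto simp: transpose_def)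
      next
        case False
        then have ak: "a < k" using k am by simp
        have x: "E a k \<in> X" using ak pre b k by (intro strand_pair_in) auto
        have 1: "E a m = c k (E a k)" using k ak by (auto simp: strand_pair_next)
        have 2: "c m (E a k) = E a k"
          using ih[of k a m] ak pre b k by (auto simp: transpose_def)
        \<comment> \<open>The braid relation for \<open>k\<close> and \<open>m = k + 1\<close>
          brings a \<open>c m\<close> next to \<open>E a k\<close>, where it disappears because both
          strands of that pair lie below \<open>m\<close>.\<close>
        have "c k (c m (c k (E a k))) = c m (c k (c m (E a k)))"
          using c_braid[of k "E a k"] x k pre b ak by auto
        then show ?thesis using Eb 1 2 k b ak by (auto simp: transpose_def)
      qed
    next
      case k: 5
      have "c k (E a b) = c m (c k (E a m))"
        using c_far[of k m "E a m"] Em Eb pre k b by auto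
      also have "c k (E a m) = E (transpose k (k+1) a) m"
        using ih[of m a k] pre am b k by (auto simp: transpose_def)
      also have "c m \<dots> = E (transpose k (k+1) a) b"
        using k am b by (auto simp: strand_pair_next transpose_def)
      finally show ?thesis using k b pre by (auto simp: transpose_def)
    qed
  qed
qed

end

section \<open>Braids with prescribed effect on strands\<close>

text \<open>Conjugating the transposition of \<open>a, m\<close> by that of \<open>m, m+1\<close>
  gives that of \<open>a, m+1\<close>, so the words grow from both ends.\<close>

lemma transpose_word:
  assumes "a \<in> {1..n}" "b \<in> {1..n}"
  shows "\<exists>w \<in> lists (braid_gens n). word_perm w = transpose a b"
proof -
  have "\<exists>w \<in> lists (braid_gens n). word_perm w = transpose a b"
    if "1 \<le> a" "a \<le> b" "b \<le> n" for a b
    using that(2,1,3)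
  proof (induction b rule: dec_induct)
    case base
    then show ?case by (intro bexI[of _ "[]"]) auto
  next
    case (step m)
    then obtain w where w: "w \<in> lists (braid_gens n)" "word_perm w = transpose a m" by auto
    show ?case
    proof (cases "a = m")
      case True
      then show ?thesis
        using step by (intro bexI[of _ "[Sig m]"]) (auto simp: braid_gens_def)
    next
      case False
      then have "word_perm ([Sig m] @ w @ [Sig m]) = transpose a (Suc m)"
        using w step by (auto simp: fun_eq_iff transpose_def)
      moreover have "[Sig m] @ w @ [Sig m] \<in> lists (braid_gens n)"
        using w step by (auto simp: braid_gens_def)
      ultimately show ?thesis by blast
    qed
  qed
  from this[of a b] this[of b a] assms show ?thesis
    by (cases "a \<le> b") (auto simp: transpose_commute)
qed

text \<open>With this, relations among ties need checking on the first few strands only. Once a word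
  handles the tails, a transposition corrects the head; it fixes \<open>ys\<close>, since neither of
  the points it exchanges lies there.\<close>

lemma braid_word_transitive:
  assumes "length xs = length ys" "distinct xs" "distinct ys" "set xs \<subseteq> {1..n}" "set ys \<subseteq> {1..n}"
  shows "\<exists>w \<in> lists (braid_gens n). map (word_perm w) xs = ys"
  using assms
proof (induction xs ys rule: list_induct2)
  case Nil
  then show ?case by (intro bexI[of _ "[]"]) auto
next
  case (Cons x xs y ys)
  then obtain w where w: "w \<in> lists (braid_gens n)" "map (word_perm w) xs = ys" by auto
  have p: "word_perm w permutes {1..n}" using w(1) by (rule word_perm_permutes)
  then have "word_perm w x \<in> {1..n}" using Cons.prems by (simp only: permutes_in_image) auto
  then obtain v where v: "v \<in> lists (braid_gens n)" "word_perm v = transpose (word_perm w x) y"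
    using transpose_word[of "word_perm w x" n y] Cons.prems by auto
  have "word_perm w x \<notin> set ys"
    using w(2) Cons.prems permutes_inj[OF p] by (auto dest: injD)
  then have "word_perm v z = z" if "z \<in> set ys" for z
    using that v(2) Cons.prems by (auto simp: transpose_def)
  then have "map (word_perm (v @ w)) (x # xs) = y # ys"
    using w(2)[symmetric] v(2) by auto
  then show ?case using w(1) v(1) by (intro bexI[of _ "v @ w"]) auto
qed


section \<open>Joins of set partitions\<close>

text \<open>For \<open>a = b\<close> in \<open>A\<close> the value is the discrete partition, which
  matches the convention for \<open>tie\<close> below.\<close>

definition tie_partition :: "'a set \<Rightarrow> 'a \<Rightarrow> 'a \<Rightarrow> 'a set set" where
  "tie_partition A a b = insert {a, b} ((\<lambda>i. {i}) ` (A - {a, b}))"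

lemma partition_on_tie_partition:
  "a \<in> A \<Longrightarrow> b \<in> A \<Longrightarrow> partition_on A (tie_partition A a b)"
  by (rule partition_onI) (auto simp: tie_partition_def disjnt_def)

lemma tie_partition_same: "a \<in> A \<Longrightarrow> tie_partition A a a = (\<lambda>i. {i}) ` A"
  by (auto simp: tie_partition_def)

lemma tie_partition_commute: "tie_partition A a b = tie_partition A b a"
  by (simp add: tie_partition_def insert_commute)

lemma partition_act_tie_partition:
  assumes "w permutes A"
  shows "partition_act w (tie_partition A a b) = tie_partition A (w a) (w b)"
proof -
  have "w ` (A - {a, b}) = A - {w a, w b}"
    using permutes_image[OF assms] permutes_inj[OF assms] by (simp add: image_set_diff)
  then have "(\<lambda>i. {w i}) ` (A - {a, b}) = (\<lambda>i. {i}) ` (A - {w a, w b})"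
    by (simp add: image_image[of "\<lambda>i. {i}" w, symmetric])
  then show ?thesis
    by (simp add: tie_partition_def partition_act_def image_image)
qed

section \<open>Set partitions as equivalence relations\<close>

definition same_block :: "'a set set \<Rightarrow> 'a \<Rightarrow> 'a \<Rightarrow> bool" where
  "same_block L a b \<longleftrightarrow> (\<exists>B\<in>L. a \<in> B \<and> b \<in> B)"

lemma same_block_in: "partition_on A L \<Longrightarrow> same_block L a b \<Longrightarrow> B \<in> L \<Longrightarrow> a \<in> B \<Longrightarrow> b \<in> B"
  using partition_onD2[of A L] unfolding same_block_def disjoint_def by blast

lemma same_block_refl: "partition_on A L \<Longrightarrow> a \<in> A \<Longrightarrow> same_block L a a"
  by (auto simp: same_block_def dest: partition_onD1)

lemma same_block_sym: "same_block L a b \<Longrightarrow> same_block L b a"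
  by (auto simp: same_block_def)

lemma same_block_trans:
  "partition_on A L \<Longrightarrow> same_block L a b \<Longrightarrow> same_block L b d \<Longrightarrow> same_block L a d"
  using same_block_in[of A L b d] unfolding same_block_def by blast

text \<open>A block of \<open>L\<close> that meets a block of \<open>I\<close> contains it, so
  refinement is inclusion of equivalence relations.\<close>

lemma partition_le_iff_same_block:
  assumes I: "partition_on A I" and L: "partition_on A L"
  shows "I \<preceq> L \<longleftrightarrow> (\<forall>a b. same_block I a b \<longrightarrow> same_block L a b)"
proof (intro iffI allI impI)
  fix a b assume le: "I \<preceq> L" and "same_block I a b"
  then obtain X where X: "X \<in> I" "a \<in> X" "b \<in> X" by (auto simp: same_block_def)
  then obtain B where B: "B \<in> L" "a \<in> B"
    using partition_onD1[OF I] partition_onD1[OF L] by blast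
  with le obtain Y where Y: "Y \<in> I" "a \<in> Y" "Y \<subseteq> B" by (meson partition_leE)
  with X partition_onD2[OF I] have "X = Y" unfolding disjoint_def by blast
  with X Y B show "same_block L a b" by (auto simp: same_block_def)
next
  assume *: "\<forall>a b. same_block I a b \<longrightarrow> same_block L a b"
  show "I \<preceq> L"
  proof (rule partition_leI)
    fix B x assume B: "B \<in> L" "x \<in> B"
    then obtain X where "X \<in> I" "x \<in> X"
      using partition_onD1[OF I] partition_onD1[OF L] by blast
    moreover from this have "y \<in> B" if "y \<in> X" for y
      using that * same_block_in[OF L _ B] unfolding same_block_def by blast
    ultimately show "\<exists>X\<in>I. x \<in> X \<and> X \<subseteq> B" by blast
  qed
qed

text \<open>Apart from \<open>{a, b}\<close> only singletons occur, and these relate no two distinct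
  points. A tie thus imposes a single condition on the partitions above it.\<close>

lemma tie_partition_le_iff:
  assumes "a \<in> A" "b \<in> A" and L: "partition_on A L"
  shows "tie_partition A a b \<preceq> L \<longleftrightarrow> same_block L a b"
proof -
  have T: "partition_on A (tie_partition A a b)"
    using assms(1,2) by (rule partition_on_tie_partition)
  have "{a, b} \<in> tie_partition A a b" by (simp add: tie_partition_def)
  then have ab: "same_block (tie_partition A a b) a b" by (auto simp: same_block_def)
  have "same_block L x y" if "same_block L a b" "same_block (tie_partition A a b) x y" for x y
  proof -
    from that(2) consider "x \<in> A" "x = y" | "x = a" "y = b" | "x = b" "y = a"
      using assms(1,2) unfolding same_block_def tie_partition_def by auto
    then show ?thesis
      using that(1) same_block_sym[of L a b] same_block_refl[OF L] by cases auto
  qed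
  with ab show ?thesis
    unfolding partition_le_iff_same_block[OF T L] by blast
qed

lemma partition_join_le_iff:
  assumes "partition_on A I" "partition_on A J" "partition_on A L"
  shows "partition_join A I J \<preceq> L \<longleftrightarrow> I \<preceq> L \<and> J \<preceq> L"
  using is_partition_join_partition_join[OF assms(1,2)] assms(3)
  unfolding is_partition_join_def by (meson partition_le_trans)

lemma partition_on_join:
  "partition_on A I \<Longrightarrow> partition_on A J \<Longrightarrow> partition_on A (partition_join A I J)"
  using is_partition_join_partition_join unfolding is_partition_join_def by blast

text \<open>A join is known through its upper bounds, so identities between joins are proved by
  comparing these. Taking \<open>L\<close> to be \<open>I\<close> and then \<open>J\<close> gives
  both inequalities.\<close>

lemma partition_eqI_upper_bounds:
  assumes "partition_on A I" "partition_on A J"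
    and "\<And>L. partition_on A L \<Longrightarrow> I \<preceq> L \<longleftrightarrow> J \<preceq> L"
  shows "I = J"
  using assms(3)[OF assms(1)] assms(3)[OF assms(2)] partition_le_antisym[OF assms(1,2)]
  by (simp add: partition_le_refl)

lemma partition_join_commute: "partition_join A I J = partition_join A J I"
  by (simp add: partition_join_def is_partition_join_def conj_left_commute conj_commute)

lemma partition_join_assoc:
  assumes "partition_on A I" "partition_on A J" "partition_on A K"
  shows "partition_join A (partition_join A I J) K = partition_join A I (partition_join A J K)"
  by (rule partition_eqI_upper_bounds[of A])
    (use assms in \<open>auto simp: partition_join_le_iff partition_on_join\<close>)

lemma partition_join_idem: "partition_on A I \<Longrightarrow> partition_join A I I = I"
  by (intro partition_join_eqI) (auto simp: is_partition_join_def partition_le_refl)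

lemma singletons_le: "partition_on A L \<Longrightarrow> (\<lambda>i. {i}) ` A \<preceq> L"
  using partition_onD1[of A L] by (intro partition_leI) blast

lemma partition_join_singletons:
  assumes "partition_on A I"
  shows "partition_join A I ((\<lambda>i. {i}) ` A) = I" "partition_join A ((\<lambda>i. {i}) ` A) I = I"
  using assms
  by (auto intro!: partition_join_eqI simp: is_partition_join_def partition_le_refl singletons_le)

lemma partition_act_singletons: "w permutes A \<Longrightarrow> partition_act w ((\<lambda>i. {i}) ` A) = (\<lambda>i. {i}) ` A"
  by (simp add: partition_act_def image_image image_image[of "\<lambda>i. {i}" w, symmetric] permutes_image)

text \<open>Both sides lie below exactly the partitions that put \<open>a\<close>, \<open>b\<close>
  and \<open>d\<close> in one block.\<close>

lemma tie_partition_join_triangle: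
  assumes "a \<in> A" "b \<in> A" "d \<in> A"
  shows "partition_join A (tie_partition A a b) (tie_partition A b d)
    = partition_join A (tie_partition A b d) (tie_partition A a d)"
proof (rule partition_eqI_upper_bounds[of A])
  fix L assume L: "partition_on A L"
  have "same_block L a b \<and> same_block L b d \<longleftrightarrow> same_block L b d \<and> same_block L a d"
    using same_block_trans[OF L] same_block_sym by metis
  then show "partition_join A (tie_partition A a b) (tie_partition A b d) \<preceq> L
    \<longleftrightarrow> partition_join A (tie_partition A b d) (tie_partition A a d) \<preceq> L"
    using assms L
    by (simp add: partition_join_le_iff partition_on_tie_partition tie_partition_le_iff)
qed (use assms in \<open>auto intro!: partition_on_join partition_on_tie_partition\<close>)

section \<open>Ties between arbitrary strands\<close>

context
  fixes n :: nat
begin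

abbreviation (input) T where "T \<equiv> tied_braid_monoid n"
abbreviation tcl where "tcl \<equiv> pres_class (tied_gens n) (tied_rel n)"

interpretation T: monoid "tied_braid_monoid n"
  by (rule monoid_tied_braid_monoid)

lemma tied_class_closed: "w \<in> lists (tied_gens n) \<Longrightarrow> tcl w \<in> carrier T"
  by (simp add: tied_braid_monoid_def tied.carrier_presented)

lemma tied_class_mult:
  "u \<in> lists (tied_gens n) \<Longrightarrow> v \<in> lists (tied_gens n) \<Longrightarrow> tcl u \<otimes>\<^bsub>T\<^esub> tcl v = tcl (u @ v)"
  by (simp add: tied_braid_monoid_def tied.pres_class_mult)

lemma tied_class_Nil: "\<one>\<^bsub>T\<^esub> = tcl []"
  by (simp add: tied_braid_monoid_def tied.one_presented)

lemma tied_class_rel: "tied_rel n u v \<Longrightarrow> tcl u = tcl v"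
  using pres_cong.rel[of "tied_rel n" u v "[]" "tied_gens n" "[]"]
  by (intro tied.pres_class_eqI) simp

text \<open>This provides the natural map from the braid group to the tied braid monoid; injectivity
  later uses it to identify the braid factors of two normal forms.\<close>

lemma tied_class_braid_cong:
  "pres_cong (braid_gens n) (braid_rel n) u v \<Longrightarrow> tcl (map Braid u) = tcl (map Braid v)"
proof (induction rule: pres_cong.induct)
  case (rel u v x y)
  have "map Braid x \<in> lists (tied_gens n)" "map Braid y \<in> lists (tied_gens n)"
    using rel by (auto simp: tied_gens_def)
  with pres_cong.rel[of "tied_rel n", OF tied_rel.braid[OF rel(1)] this] show ?case
    by (intro tied.pres_class_eqI) simp
qed auto

section \<open>The defining relations in terms of conjugation\<close>

abbreviation sig where "sig i \<equiv> tcl [Braid (Sig i)]"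
abbreviation sig_inv where "sig_inv i \<equiv> tcl [Braid (Sig_inv i)]"
abbreviation eta where "eta i \<equiv> tcl [Eta i]"

lemma tied_letters [simp]:
  "i \<in> {1..<n} \<Longrightarrow> Braid (Sig i) \<in> tied_gens n"
  "i \<in> {1..<n} \<Longrightarrow> Braid (Sig_inv i) \<in> tied_gens n"
  "i \<in> {1..<n} \<Longrightarrow> Eta i \<in> tied_gens n"
  by (auto simp: tied_gens_def braid_gens_def)

lemma sig_unit:
  assumes "i \<in> {1..<n}"
  shows "sig i \<in> Units T" "inv\<^bsub>T\<^esub> (sig i) = sig_inv i"
proof -
  have c: "sig i \<in> carrier T" "sig_inv i \<in> carrier T"
    using assms by (auto intro!: tied_class_closed simp del: atLeastLessThan_iff)
  have "sig i \<otimes>\<^bsub>T\<^esub> sig_inv i = \<one>\<^bsub>T\<^esub>" "sig_inv i \<otimes>\<^bsub>T\<^esub> sig i = \<one>\<^bsub>T\<^esub>"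
    using assms tied_class_rel[OF tied_rel.braid[OF braid_rel.inv_right[OF assms]]]
      tied_class_rel[OF tied_rel.braid[OF braid_rel.inv_left[OF assms]]]
    by (simp_all add: tied_class_mult tied_class_Nil del: atLeastLessThan_iff)
  with c show "sig i \<in> Units T" "inv\<^bsub>T\<^esub> (sig i) = sig_inv i"
    using T.inv_unique'[of "sig i" "sig_inv i"] by (auto simp: Units_def)
qed

lemma eta_closed: "i \<in> {1..<n} \<Longrightarrow> eta i \<in> carrier T"
  by (intro tied_class_closed) (simp del: atLeastLessThan_iff)

lemma conjugate_sig_far:
  assumes ij: "i \<in> {1..<n}" "j \<in> {1..<n}" "\<bar>int i - int j\<bar> > 1" and x: "x \<in> carrier T"
  shows "T.conjugate_by (sig i) (T.conjugate_by (sig j) x)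
    = T.conjugate_by (sig j) (T.conjugate_by (sig i) x)"
proof -
  have "sig i \<otimes>\<^bsub>T\<^esub> sig j = sig j \<otimes>\<^bsub>T\<^esub> sig i"
    using ij tied_class_rel[OF tied_rel.braid[OF braid_rel.far[OF ij]]]
    by (simp add: tied_class_mult del: atLeastLessThan_iff)
  then show ?thesis
    using T.conjugate_by_comp[of "sig i" "sig j" x] T.conjugate_by_comp[of "sig j" "sig i" x]
      sig_unit ij x by simp
qed

lemma conjugate_sig_braid:
  assumes ij: "i \<in> {1..<n}" "i + 1 \<in> {1..<n}" and x: "x \<in> carrier T"
  shows "T.conjugate_by (sig i) (T.conjugate_by (sig (i+1)) (T.conjugate_by (sig i) x))
    = T.conjugate_by (sig (i+1)) (T.conjugate_by (sig i) (T.conjugate_by (sig (i+1)) x))"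
proof -
  note u = sig_unit(1)[OF ij(1)] sig_unit(1)[OF ij(2)]
  have "sig i \<otimes>\<^bsub>T\<^esub> (sig (i+1) \<otimes>\<^bsub>T\<^esub> sig i) = sig (i+1) \<otimes>\<^bsub>T\<^esub> (sig i \<otimes>\<^bsub>T\<^esub> sig (i+1))"
    using ij tied_class_rel[OF tied_rel.braid[OF braid_rel.braid[OF ij]]]
    by (simp add: tied_class_mult del: atLeastLessThan_iff)
  moreover have "T.conjugate_by (p \<otimes>\<^bsub>T\<^esub> (q \<otimes>\<^bsub>T\<^esub> r)) x
      = T.conjugate_by p (T.conjugate_by q (T.conjugate_by r x))"
    if "p \<in> Units T" "q \<in> Units T" "r \<in> Units T" for p q r
    using that x by (simp add: T.conjugate_by_comp)
  ultimately show ?thesis using u by metis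
qed

lemma conjugate_sig_eta_same:
  assumes "i \<in> {1..<n}"
  shows "T.conjugate_by (sig i) (eta i) = eta i"
  using assms tied_class_rel[OF tied_rel.eta_sigma[OF assms]] sig_unit[OF assms] eta_closed[OF assms]
  by (simp add: T.conjugate_by_eq_iff tied_class_mult del: atLeastLessThan_iff)

lemma conjugate_sig_eta_far:
  assumes ij: "i \<in> {1..<n}" "j \<in> {1..<n}" "\<bar>int i - int j\<bar> > 1"
  shows "T.conjugate_by (sig j) (eta i) = eta i"
  using ij(1,2) tied_class_rel[OF tied_rel.eta_sigma_far[OF ij]] sig_unit[OF ij(2)] eta_closed[OF ij(1)]
  by (simp add: T.conjugate_by_eq_iff tied_class_mult del: atLeastLessThan_iff)

lemma conjugate_sig_sig_eta:
  assumes ij: "i \<in> {1..<n}" "j \<in> {1..<n}" "\<bar>int i - int j\<bar> = 1"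
  shows "T.conjugate_by (sig j) (T.conjugate_by (sig i) (eta j)) = eta i"
proof -
  have "eta i \<otimes>\<^bsub>T\<^esub> (sig j \<otimes>\<^bsub>T\<^esub> sig i) = (sig j \<otimes>\<^bsub>T\<^esub> sig i) \<otimes>\<^bsub>T\<^esub> eta j"
    using ij(1,2) tied_class_rel[OF tied_rel.slide[OF ij]]
    by (simp add: tied_class_mult del: atLeastLessThan_iff)
  then show ?thesis
    using sig_unit(1)[OF ij(1)] sig_unit(1)[OF ij(2)] eta_closed[OF ij(1)] eta_closed[OF ij(2)]
    by (simp add: T.conjugate_by_eq_iff flip: T.conjugate_by_comp)
qed

lemma conjugate_sig_inv_eta:
  assumes ij: "i \<in> {1..<n}" "j \<in> {1..<n}" "\<bar>int i - int j\<bar> = 1"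
  shows "T.conjugate_by (sig j) (T.conjugate_by (sig_inv i) (eta j)) = eta i"
proof -
  have "eta i \<otimes>\<^bsub>T\<^esub> (sig j \<otimes>\<^bsub>T\<^esub> sig_inv i) = (sig j \<otimes>\<^bsub>T\<^esub> sig_inv i) \<otimes>\<^bsub>T\<^esub> eta j"
    using ij(1,2) tied_class_rel[OF tied_rel.slide_inv[OF ij]]
    by (simp add: tied_class_mult del: atLeastLessThan_iff)
  moreover have "sig_inv i \<in> Units T"
    using T.Units_inv_Units[OF sig_unit(1)[OF ij(1)]] sig_unit(2)[OF ij(1)] by simp
  ultimately show ?thesis
    using sig_unit(1)[OF ij(2)] eta_closed[OF ij(1)] eta_closed[OF ij(2)]
    by (simp add: T.conjugate_by_eq_iff flip: T.conjugate_by_comp)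
qed

text \<open>Together, the two slide relations say that conjugating \<open>\<eta>\<^sub>j\<close> by \<open>\<sigma>\<^sub>i\<close> and by its inverse
  gives the same element when \<open>i\<close> and \<open>j\<close> are adjacent.\<close>

lemma conjugate_sig_eta_swap:
  assumes ij: "i \<in> {1..<n}" "j \<in> {1..<n}" "\<bar>int i - int j\<bar> = 1"
  shows "T.conjugate_by (sig i) (eta j) = T.conjugate_by (sig j) (eta i)"
proof -
  have ji: "\<bar>int j - int i\<bar> = 1" using ij(3) by simp
  note u = sig_unit[OF ij(1)] sig_unit[OF ij(2)]
  have u': "sig_inv i \<in> Units T" "sig_inv j \<in> Units T"
    using T.Units_inv_Units[OF u(1)] T.Units_inv_Units[OF u(3)] u by simp_all
  note e = eta_closed[OF ij(1)] eta_closed[OF ij(2)]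
  have *: "y = T.conjugate_by (sig_inv k) z"
    if "T.conjugate_by (sig k) y = z" "y \<in> carrier T" "k \<in> {1..<n}" for k y z
    using that T.conjugate_by_inv_cancel(1)[of "sig k" y] sig_unit[OF that(3)] by auto
  have "T.conjugate_by (sig i) (eta j) = T.conjugate_by (sig_inv j) (eta i)"
    using conjugate_sig_sig_eta[OF ij] u u' e ij by (intro *) auto
  moreover have "T.conjugate_by (sig_inv i) (eta j) = T.conjugate_by (sig_inv j) (eta i)"
    using conjugate_sig_inv_eta[OF ij] u u' e ij by (intro *) auto
  moreover have "T.conjugate_by (sig j) (eta i) = T.conjugate_by (sig_inv i) (eta j)"
    using conjugate_sig_sig_eta[OF ij(2,1) ji] u u' e ij by (intro *) auto
  ultimately show ?thesis by simp
qed

interpretation act: braid_action n "carrier T" "\<lambda>i. T.conjugate_by (sig i)" eta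
proof
  fix i x assume "i \<in> {1..<n}" "x \<in> carrier T"
  then show "T.conjugate_by (sig i) x \<in> carrier T" using sig_unit by blast
next
  fix i j x assume "i \<in> {1..<n}" "j \<in> {1..<n}" "i + 1 < j" "x \<in> carrier T"
  then show "T.conjugate_by (sig i) (T.conjugate_by (sig j) x)
    = T.conjugate_by (sig j) (T.conjugate_by (sig i) x)"
    by (intro conjugate_sig_far) auto
next
  fix i assume "i \<in> {1..<n}" "i + 1 \<in> {1..<n}"
  then show "T.conjugate_by (sig i) (eta (i + 1)) = T.conjugate_by (sig (i + 1)) (eta i)"
    "T.conjugate_by (sig i) (T.conjugate_by (sig (i + 1)) (eta i)) = eta (i + 1)"
    "T.conjugate_by (sig (i + 1)) (T.conjugate_by (sig i) (eta (i + 1))) = eta i"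
    by (intro conjugate_sig_eta_swap conjugate_sig_sig_eta; simp)+
qed (use eta_closed conjugate_sig_braid conjugate_sig_eta_same conjugate_sig_eta_far in blast)+

section \<open>Ties on unordered pairs and the braid action on them\<close>

text \<open>Extended symmetrically in the strands, and by the identity on the diagonal, so that
  equivariance holds for all pairs and absorption becomes reflexive and symmetric.\<close>

definition tie :: "nat \<Rightarrow> nat \<Rightarrow> tied_gen list set" where
  "tie a b = (if a = b then \<one>\<^bsub>T\<^esub>
    else strand_pair (\<lambda>i. T.conjugate_by (sig i)) eta (min a b) (max a b))"

lemma tie_same [simp]: "tie a a = \<one>\<^bsub>T\<^esub>"
  by (simp add: tie_def)

lemma tie_commute: "tie a b = tie b a"
  by (simp add: tie_def min.commute max.commute)

lemma tie_adjacent: "tie i (Suc i) = eta i"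
  by (simp add: tie_def)

lemma tie_closed [simp]: "a \<in> {1..n} \<Longrightarrow> b \<in> {1..n} \<Longrightarrow> tie a b \<in> carrier T"
  by (auto simp: tie_def min_def max_def intro!: act.strand_pair_in)

text \<open>For unordered pairs the exception in \<open>strand_pair_equivariant\<close> disappears:
  reversing \<open>(k, k+1)\<close> gives the same tie, which \<open>sig k\<close> fixes.\<close>

lemma conjugate_sig_tie:
  assumes k: "k \<in> {1..<n}" and "a \<in> {1..n}" "b \<in> {1..n}"
  shows "T.conjugate_by (sig k) (tie a b) = tie (transpose k (k+1) a) (transpose k (k+1) b)"
proof -
  have *: "T.conjugate_by (sig k) (tie a b) = tie (transpose k (k+1) a) (transpose k (k+1) b)"
    if ab: "a < b" "1 \<le> a" "b \<le> n" for a b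
  proof (cases "k = a \<and> b = Suc a")
    case True
    then show ?thesis
      using conjugate_sig_eta_same[OF k] tie_adjacent tie_commute by simp
  next
    case False
    \<comment> \<open>Outside the exceptional pair, an adjacent transposition preserves the order of
      \<open>a\<close> and \<open>b\<close>, so \<open>min\<close> and \<open>max\<close> pick the
      corresponding strands.\<close>
    then have "transpose k (k+1) a < transpose k (k+1) b"
      using ab by (auto simp: transpose_def)
    then show ?thesis
      using act.strand_pair_equivariant[of a b k] ab k False
      by (simp add: tie_def min_def max_def)
  qed
  show ?thesis
  proof (cases a b rule: linorder_cases)
    case equal
    then show ?thesis using sig_unit(1)[OF k] by simp
  next
    case less
    then show ?thesis using * assms by auto
  next
    case greater
    then show ?thesis using *[of b a] assms tie_commute by auto
  qed
qed

abbreviation braid_of where "braid_of w \<equiv> tcl (map Braid w)"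

lemma map_Braid_words [simp]: "w \<in> lists (braid_gens n) \<Longrightarrow> map Braid w \<in> lists (tied_gens n)"
  by (auto simp: tied_gens_def)

text \<open>Invertibility is carried through the induction because composing conjugations requires
  units. The action factors through \<pi>, since \<sigma>_i and its inverse act alike on
  ties.\<close>

lemma braid_of_unit_conjugate:
  assumes "w \<in> lists (braid_gens n)"
  shows "braid_of w \<in> Units T \<and> (\<forall>a\<in>{1..n}. \<forall>b\<in>{1..n}.
    T.conjugate_by (braid_of w) (tie a b) = tie (word_perm w a) (word_perm w b))"
  using assms
proof (induction w)
  case Nil
  then show ?case by (simp flip: tied_class_Nil)
next
  case (Cons g w)
  have w: "w \<in> lists (braid_gens n)" using Cons by simp
  then have p: "word_perm w permutes {1..n}" by (rule word_perm_permutes)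
  have bw: "braid_of (g # w) = tcl [Braid g] \<otimes>\<^bsub>T\<^esub> braid_of w"
    using Cons.hyps map_Braid_words[OF w] by (subst tied_class_mult) (auto simp: tied_gens_def)
  have g: "tcl [Braid g] \<in> Units T \<and> (\<forall>a\<in>{1..n}. \<forall>b\<in>{1..n}.
    T.conjugate_by (tcl [Braid g]) (tie a b) = tie (gen_perm g a) (gen_perm g b))"
  proof -
    from Cons.hyps(1) consider i where "i \<in> {1..<n}" "g = Sig i" | i where "i \<in> {1..<n}" "g = Sig_inv i"
      unfolding braid_gens_def by blast
    then show ?thesis
    proof cases
      case 1
      then show ?thesis using sig_unit(1) conjugate_sig_tie by simp
    next
      case (2 i)
      let ?t = "transpose i (i+1)"
      note u = sig_unit[OF 2(1)]
      have "T.conjugate_by (sig_inv i) (tie a b) = tie (?t a) (?t b)"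
        if ab: "a \<in> {1..n}" "b \<in> {1..n}" for a b
      proof -
        have t: "?t a \<in> {1..n}" "?t b \<in> {1..n}" using ab 2(1) by (auto simp: transpose_def)
        \<comment> \<open>The action of \<open>sig i\<close> on the transposed pair returns the
          original pair, as \<open>?t\<close> is an involution; conjugating back by the inverse
          gives the claim.\<close>
        have "T.conjugate_by (sig i) (tie (?t a) (?t b)) = tie a b"
          using conjugate_sig_tie[OF 2(1) t] by simp
        then show ?thesis
          using T.conjugate_by_inv_cancel(1)[OF u(1) tie_closed[OF t]] u(2) by simp
      qed
      moreover have "sig_inv i \<in> Units T" using T.Units_inv_Units[OF u(1)] u(2) by simp
      ultimately show ?thesis using 2 by simp
    qed
  qed
  show ?case
  proof (intro conjI ballI)
    show "braid_of (g # w) \<in> Units T"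
      unfolding bw using g Cons.IH w by blast
    fix a b assume ab: "a \<in> {1..n}" "b \<in> {1..n}"
    then have wab: "word_perm w a \<in> {1..n}" "word_perm w b \<in> {1..n}"
      using permutes_in_image[OF p] by blast+
    have "T.conjugate_by (braid_of (g # w)) (tie a b)
        = T.conjugate_by (tcl [Braid g]) (T.conjugate_by (braid_of w) (tie a b))"
      unfolding bw using g Cons.IH w ab by (intro T.conjugate_by_comp) auto
    also have "\<dots> = tie (word_perm (g # w) a) (word_perm (g # w) b)"
      using g Cons.IH w ab wab by simp
    finally show "T.conjugate_by (braid_of (g # w)) (tie a b)
      = tie (word_perm (g # w) a) (word_perm (g # w) b)" .
  qed
qed

lemmas braid_of_unit = braid_of_unit_conjugate[THEN conjunct1]

lemma conjugate_braid_of_tie: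
  "w \<in> lists (braid_gens n) \<Longrightarrow> a \<in> {1..n} \<Longrightarrow> b \<in> {1..n} \<Longrightarrow>
    T.conjugate_by (braid_of w) (tie a b) = tie (word_perm w a) (word_perm w b)"
  using braid_of_unit_conjugate by blast

lemma conjugate_braid_of_tie_mult:
  assumes "w \<in> lists (braid_gens n)" "a \<in> {1..n}" "b \<in> {1..n}" "d \<in> {1..n}" "e \<in> {1..n}"
  shows "T.conjugate_by (braid_of w) (tie a b \<otimes>\<^bsub>T\<^esub> tie d e)
    = tie (word_perm w a) (word_perm w b) \<otimes>\<^bsub>T\<^esub> tie (word_perm w d) (word_perm w e)"
  using assms
  by (subst T.conjugate_by_mult) (auto simp: braid_of_unit conjugate_braid_of_tie simp del: atLeastAtMost_iff)

section \<open>Relations between ties on arbitrary strands\<close>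

text \<open>A braid carrying strands 1, 2 to \<open>a\<close>, \<open>b\<close> conjugates
  \<open>eta 1\<close> to \<open>tie a b\<close>, and conjugation preserves idempotents.\<close>

lemma tie_idem:
  assumes ab: "a \<in> {1..n}" "b \<in> {1..n}"
  shows "tie a b \<otimes>\<^bsub>T\<^esub> tie a b = tie a b"
proof (cases "a = b")
  case False
  then have 1: "1 \<in> {1..<n}" and 12: "1 \<in> {1..n}" "Suc 1 \<in> {1..n}" using ab by auto
  obtain w where w: "w \<in> lists (braid_gens n)" "map (word_perm w) [1, Suc 1] = [a, b]"
    using braid_word_transitive[of "[1, Suc 1]" "[a, b]" n] ab False 12 by auto
  have "eta 1 \<otimes>\<^bsub>T\<^esub> eta 1 = eta 1"
    using 1 tied_class_rel[OF tied_rel.eta_idem[OF 1]]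
    by (simp add: tied_class_mult del: atLeastLessThan_iff)
  then have "tie 1 (Suc 1) \<otimes>\<^bsub>T\<^esub> tie 1 (Suc 1) = tie 1 (Suc 1)" by (simp only: tie_adjacent)
  then show ?thesis
    using conjugate_braid_of_tie_mult[OF w(1) 12 12] conjugate_braid_of_tie[OF w(1) 12] w(2)
    by (auto simp del: atLeastAtMost_iff)
qed simp

text \<open>By transitivity of the braid action, strands 1, 2, 3 suffice. There \<eta>_1 \<eta>_2
  \<sigma>_1 = \<eta>_2 \<sigma>_1 \<eta>_2, and \<sigma>_1 \<eta>_2 equals \<open>tie 1 3\<close>
  times \<sigma>_1; cancelling \<sigma>_1 gives the first identity. The second is the commutation of
  \<eta>_1 and \<eta>_2.\<close>

lemma tie_triangle:
  assumes abd: "a \<in> {1..n}" "b \<in> {1..n}" "d \<in> {1..n}" and dist: "distinct [a, b, d]"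
  shows "tie a b \<otimes>\<^bsub>T\<^esub> tie b d = tie b d \<otimes>\<^bsub>T\<^esub> tie a d"
    and "tie a b \<otimes>\<^bsub>T\<^esub> tie b d = tie b d \<otimes>\<^bsub>T\<^esub> tie a b"
proof -
  \<comment> \<open>Three distinct strands force \<open>3 \<le> n\<close>, which makes the
    generators of index 1 and 2 available.\<close>
  have "card {a, b, d} \<le> card {1..n}" using abd by (intro card_mono) auto
  then have "3 \<le> n" using dist by simp
  then have 1: "1 \<in> {1..<n}" "2 \<in> {1..<n}" and 123: "1 \<in> {1..n}" "2 \<in> {1..n}" "3 \<in> {1..n}" by auto
  obtain w where w: "w \<in> lists (braid_gens n)" "map (word_perm w) [1, 2, 3] = [a, b, d]"
  proof -
    have "\<exists>w \<in> lists (braid_gens n). map (word_perm w) [1, 2, 3] = [a, b, d]"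
      by (rule braid_word_transitive) (use abd dist 123 in simp_all)
    then show ?thesis by (elim bexE) (rule that)
  qed
  have wv: "word_perm w 1 = a" "word_perm w 2 = b" "word_perm w 3 = d" using w(2) by auto
  have e: "tie 1 2 = eta 1" "tie 2 3 = eta 2"
    using tie_adjacent[of 1, unfolded Suc_1] tie_adjacent[of 2] by simp_all
  note c = eta_closed[OF 1(1)] eta_closed[OF 1(2)] and u = sig_unit(1)[OF 1(1)]
  \<comment> \<open>By definition this tie is \<open>eta 1\<close> conjugated by
    \<open>sig 2\<close>; the form needed here comes from moving \<open>tie 2 3\<close> by
    \<open>sig 1\<close>.\<close>
  have t13: "tie 1 3 = T.conjugate_by (sig 1) (eta 2)"
    using conjugate_sig_tie[OF 1(1) 123(2,3)] e by (simp add: transpose_def)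
  have "eta 1 \<otimes>\<^bsub>T\<^esub> eta 2 \<otimes>\<^bsub>T\<^esub> sig 1 = eta 2 \<otimes>\<^bsub>T\<^esub> (sig 1 \<otimes>\<^bsub>T\<^esub> eta 2)"
    using 1 tied_class_rel[OF tied_rel.eta_eta_sigma1[OF 1]]
    by (simp add: tied_class_mult del: atLeastLessThan_iff)
  also have "sig 1 \<otimes>\<^bsub>T\<^esub> eta 2 = tie 1 3 \<otimes>\<^bsub>T\<^esub> sig 1"
    unfolding t13 using T.conjugate_by_commute[OF u c(2)] by simp
  finally have "(eta 1 \<otimes>\<^bsub>T\<^esub> eta 2) \<otimes>\<^bsub>T\<^esub> sig 1 = (eta 2 \<otimes>\<^bsub>T\<^esub> tie 1 3) \<otimes>\<^bsub>T\<^esub> sig 1"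
    using c u 123 by (simp add: T.m_assoc T.Units_closed del: atLeastAtMost_iff)
  then have "(eta 1 \<otimes>\<^bsub>T\<^esub> eta 2) \<otimes>\<^bsub>T\<^esub> sig 1 \<otimes>\<^bsub>T\<^esub> inv\<^bsub>T\<^esub> sig 1
    = (eta 2 \<otimes>\<^bsub>T\<^esub> tie 1 3) \<otimes>\<^bsub>T\<^esub> sig 1 \<otimes>\<^bsub>T\<^esub> inv\<^bsub>T\<^esub> sig 1" by simp
  then have "tie 1 2 \<otimes>\<^bsub>T\<^esub> tie 2 3 = tie 2 3 \<otimes>\<^bsub>T\<^esub> tie 1 3"
    unfolding e using c u 123 by (simp add: T.m_assoc T.Units_closed del: atLeastAtMost_iff)
  from arg_cong[OF this, of "T.conjugate_by (braid_of w)"]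
  show "tie a b \<otimes>\<^bsub>T\<^esub> tie b d = tie b d \<otimes>\<^bsub>T\<^esub> tie a d"
    by (simp only: conjugate_braid_of_tie_mult[OF w(1) 123(1,2,2,3)]
      conjugate_braid_of_tie_mult[OF w(1) 123(2,3,1,3)] wv)
  have "tie 1 2 \<otimes>\<^bsub>T\<^esub> tie 2 3 = tie 2 3 \<otimes>\<^bsub>T\<^esub> tie 1 2"
    unfolding e using 1 tied_class_rel[OF tied_rel.eta_comm[OF 1]]
    by (simp add: tied_class_mult del: atLeastLessThan_iff)
  from arg_cong[OF this, of "T.conjugate_by (braid_of w)"]
  show "tie a b \<otimes>\<^bsub>T\<^esub> tie b d = tie b d \<otimes>\<^bsub>T\<^esub> tie a b"
    by (simp only: conjugate_braid_of_tie_mult[OF w(1) 123(1,2,2,3)]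
      conjugate_braid_of_tie_mult[OF w(1) 123(2,3,1,2)] wv)
qed

text \<open>The same transport, starting from the commuting \<open>eta 1\<close> and
  \<open>eta 3\<close>.\<close>

lemma tie_disjoint_commute:
  assumes abde: "a \<in> {1..n}" "b \<in> {1..n}" "d \<in> {1..n}" "e \<in> {1..n}" and dist: "distinct [a, b, d, e]"
  shows "tie a b \<otimes>\<^bsub>T\<^esub> tie d e = tie d e \<otimes>\<^bsub>T\<^esub> tie a b"
proof -
  have "card {a, b, d, e} \<le> card {1..n}" using abde by (intro card_mono) auto
  then have "4 \<le> n" using dist by simp
  then have 1: "1 \<in> {1..<n}" "3 \<in> {1..<n}"
    and 1234: "1 \<in> {1..n}" "2 \<in> {1..n}" "3 \<in> {1..n}" "4 \<in> {1..n}" by auto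
  obtain w where w: "w \<in> lists (braid_gens n)" "map (word_perm w) [1, 2, 3, 4] = [a, b, d, e]"
  proof -
    have "\<exists>w \<in> lists (braid_gens n). map (word_perm w) [1, 2, 3, 4] = [a, b, d, e]"
      by (rule braid_word_transitive) (use abde dist 1234 in simp_all)
    then show ?thesis by (elim bexE) (rule that)
  qed
  have wv: "word_perm w 1 = a" "word_perm w 2 = b" "word_perm w 3 = d" "word_perm w 4 = e"
    using w(2) by auto
  have e: "tie 1 2 = eta 1" "tie 3 4 = eta 3"
    using tie_adjacent[of 1, unfolded Suc_1] tie_adjacent[of 3] by simp_all
  have "tie 1 2 \<otimes>\<^bsub>T\<^esub> tie 3 4 = tie 3 4 \<otimes>\<^bsub>T\<^esub> tie 1 2"
    unfolding e using 1 tied_class_rel[OF tied_rel.eta_comm[OF 1]]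
    by (simp add: tied_class_mult del: atLeastLessThan_iff)
  from arg_cong[OF this, of "T.conjugate_by (braid_of w)"]
  show ?thesis
    by (simp only: conjugate_braid_of_tie_mult[OF w(1) 1234(1,2,3,4)]
      conjugate_braid_of_tie_mult[OF w(1) 1234(3,4,1,2)] wv)
qed

text \<open>Two pairs of distinct strands are disjoint or share a strand, which symmetry of
  \<open>tie\<close> puts in the middle; equal pairs are the case \<open>p = r\<close>.\<close>

lemma tie_mult_commute:
  assumes A: "a \<in> {1..n}" "b \<in> {1..n}" "d \<in> {1..n}" "e \<in> {1..n}"
  shows "tie a b \<otimes>\<^bsub>T\<^esub> tie d e = tie d e \<otimes>\<^bsub>T\<^esub> tie a b"
proof -
  have share: "tie p q \<otimes>\<^bsub>T\<^esub> tie q r = tie q r \<otimes>\<^bsub>T\<^esub> tie p q"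
    if P: "p \<in> {1..n}" "q \<in> {1..n}" "r \<in> {1..n}" and "p \<noteq> q" "q \<noteq> r" for p q r
  proof (cases "p = r")
    case True
    then show ?thesis using tie_commute[of r q] by simp
  next
    case False
    then show ?thesis using that(4,5) by (intro tie_triangle(2)[OF P]) simp
  qed
  show ?thesis
  proof (cases "a = b \<or> d = e")
    case True
    then show ?thesis using tie_closed[OF A(1,2)] tie_closed[OF A(3,4)] by auto
  next
    case ne: False
    consider "a = d" | "a = e" | "b = d" | "b = e" | "distinct [a, b, d, e]"
      using ne by auto
    then show ?thesis
    proof cases
      case 1
      then show ?thesis using share[OF A(2,1,4)] ne tie_commute[of a b] by simp
    next
      case 2
      then show ?thesis using share[OF A(2,1,3)] ne tie_commute[of a b] tie_commute[of d e] by simp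
    next
      case 3
      then show ?thesis using share[OF A(1,2,4)] ne by simp
    next
      case 4
      then show ?thesis using share[OF A(1,2,3)] ne tie_commute[of d e] by simp
    next
      case 5
      then show ?thesis by (rule tie_disjoint_commute[OF A])
    qed
  qed
qed

subsection \<open>Normal forms\<close>

abbreviation pairs where "pairs \<equiv> lists ({1..n} \<times> {1..n})"

definition ties :: "(nat \<times> nat) list \<Rightarrow> tied_gen list set" where
  "ties l = foldr (\<lambda>(a, b) x. tie a b \<otimes>\<^bsub>T\<^esub> x) l \<one>\<^bsub>T\<^esub>"

lemma ties_simps [simp]:
  "ties [] = \<one>\<^bsub>T\<^esub>"
  "ties ((a, b) # l) = tie a b \<otimes>\<^bsub>T\<^esub> ties l"
  by (simp_all add: ties_def)

lemma ties_closed [simp]: "l \<in> pairs \<Longrightarrow> ties l \<in> carrier T"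
  by (induction l) (auto simp del: atLeastAtMost_iff)

lemma tie_ties_commute:
  assumes "l \<in> pairs" "a \<in> {1..n}" "b \<in> {1..n}"
  shows "tie a b \<otimes>\<^bsub>T\<^esub> ties l = ties l \<otimes>\<^bsub>T\<^esub> tie a b"
  using assms(1)
proof (induction l)
  case Nil
  then show ?case using tie_closed[OF assms(2,3)] by simp
next
  case (Cons p l)
  obtain d e where p: "p = (d, e)" "d \<in> {1..n}" "e \<in> {1..n}" using Cons.hyps by auto
  note c = tie_closed[OF assms(2,3)] tie_closed[OF p(2,3)] ties_closed[of l]
  have l: "l \<in> pairs" using Cons by simp
  have "tie a b \<otimes>\<^bsub>T\<^esub> ties (p # l) = (tie a b \<otimes>\<^bsub>T\<^esub> tie d e) \<otimes>\<^bsub>T\<^esub> ties l"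
    using c l by (simp add: p T.m_assoc)
  also have "\<dots> = tie d e \<otimes>\<^bsub>T\<^esub> (tie a b \<otimes>\<^bsub>T\<^esub> ties l)"
    using c l tie_mult_commute[OF assms(2,3) p(2,3)] by (simp add: T.m_assoc)
  also have "\<dots> = ties (p # l) \<otimes>\<^bsub>T\<^esub> tie a b"
    using c l Cons.IH by (simp add: p T.m_assoc)
  finally show ?case .
qed

lemma ties_commute:
  assumes "l \<in> pairs" "l' \<in> pairs"
  shows "ties l \<otimes>\<^bsub>T\<^esub> ties l' = ties l' \<otimes>\<^bsub>T\<^esub> ties l"
  using assms(1)
proof (induction l)
  case Nil
  then show ?case using assms(2) by simp
next
  case (Cons p l)
  obtain a b where p: "p = (a, b)" "a \<in> {1..n}" "b \<in> {1..n}" using Cons.hyps by auto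
  note c = tie_closed[OF p(2,3)] ties_closed[of l] ties_closed[OF assms(2)]
  have l: "l \<in> pairs" using Cons by simp
  have "ties (p # l) \<otimes>\<^bsub>T\<^esub> ties l' = tie a b \<otimes>\<^bsub>T\<^esub> ties l' \<otimes>\<^bsub>T\<^esub> ties l"
    using c l Cons.IH by (simp add: p T.m_assoc)
  also have "\<dots> = ties l' \<otimes>\<^bsub>T\<^esub> ties (p # l)"
    using c l tie_ties_commute[OF assms(2) p(2,3)] by (simp add: p T.m_assoc)
  finally show ?case .
qed

lemma conjugate_braid_of_ties:
  assumes w: "w \<in> lists (braid_gens n)" and l: "l \<in> pairs"
  shows "T.conjugate_by (braid_of w) (ties l) = ties (map (map_prod (word_perm w) (word_perm w)) l)"
  using l
proof (induction l)
  case Nil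
  then show ?case using braid_of_unit[OF w] by simp
next
  case (Cons p l)
  obtain a b where p: "p = (a, b)" "a \<in> {1..n}" "b \<in> {1..n}" using Cons.hyps by auto
  have "T.conjugate_by (braid_of w) (tie a b \<otimes>\<^bsub>T\<^esub> ties l)
      = T.conjugate_by (braid_of w) (tie a b) \<otimes>\<^bsub>T\<^esub> T.conjugate_by (braid_of w) (ties l)"
    using Cons.hyps tie_closed[OF p(2,3)] by (intro T.conjugate_by_mult braid_of_unit w) auto
  then show ?case
    using Cons.IH conjugate_braid_of_tie[OF w p(2,3)] by (simp add: p)
qed

text \<open>Letters are prefixed one at a time: a tie generator joins the ties already collected,
  and a braid letter passes to their right while permuting their strands.\<close>

lemma tied_normal_form:
  assumes "w \<in> lists (tied_gens n)"
  obtains l v where "l \<in> pairs" "v \<in> lists (braid_gens n)" "tcl w = ties l \<otimes>\<^bsub>T\<^esub> braid_of v"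
proof -
  have "\<exists>l\<in>pairs. \<exists>v\<in>lists (braid_gens n). tcl w = ties l \<otimes>\<^bsub>T\<^esub> braid_of v"
    using assms
  proof (induction w)
    case Nil
    show ?case
      by (intro bexI[of _ "[]"]) (simp_all flip: tied_class_Nil)
  next
    case (Cons g w)
    then obtain l v where lv: "l \<in> pairs" "v \<in> lists (braid_gens n)" "tcl w = ties l \<otimes>\<^bsub>T\<^esub> braid_of v"
      by auto
    have c: "ties l \<in> carrier T" "braid_of v \<in> carrier T"
      using ties_closed[OF lv(1)] tied_class_closed[OF map_Braid_words[OF lv(2)]] .
    have gw: "tcl (g # w) = tcl [g] \<otimes>\<^bsub>T\<^esub> (ties l \<otimes>\<^bsub>T\<^esub> braid_of v)"
      using Cons.hyps by (simp add: tied_class_mult flip: lv(3))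
    from Cons.hyps(1) consider i where "i \<in> {1..<n}" "g = Eta i" | b where "b \<in> braid_gens n" "g = Braid b"
      unfolding tied_gens_def by blast
    then show ?case
    proof cases
      case (1 i)
      then have i: "i \<in> {1..n}" "Suc i \<in> {1..n}" by auto
      have "tcl (g # w) = ties ((i, Suc i) # l) \<otimes>\<^bsub>T\<^esub> braid_of v"
        unfolding gw using c eta_closed[OF 1(1)] by (simp add: 1(2) tie_adjacent T.m_assoc)
      moreover have "(i, Suc i) # l \<in> pairs" using lv(1) i by simp
      ultimately show ?thesis using lv(2) by blast
    next
      case (2 b)
      let ?l = "map (map_prod (gen_perm b) (gen_perm b)) l"
      have b: "[b] \<in> lists (braid_gens n)" using 2 by simp
      then have "gen_perm b permutes {1..n}" using word_perm_permutes[OF b] by simp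
      then have l': "?l \<in> pairs"
        using lv(1) permutes_in_image by (fastforce simp: in_lists_conv_set)
      have u: "tcl [g] \<in> Units T" using braid_of_unit[OF b] 2 by simp
      have "tcl [g] \<otimes>\<^bsub>T\<^esub> ties l = ties ?l \<otimes>\<^bsub>T\<^esub> tcl [g]"
        using T.conjugate_by_commute[OF u c(1)] conjugate_braid_of_ties[OF b lv(1)] 2 by simp
      then have "tcl (g # w) = ties ?l \<otimes>\<^bsub>T\<^esub> (tcl [g] \<otimes>\<^bsub>T\<^esub> braid_of v)"
        unfolding gw using c u ties_closed[OF l'] T.m_assoc T.Units_closed by metis
      also have "tcl [g] \<otimes>\<^bsub>T\<^esub> braid_of v = braid_of (b # v)"
        using 2 lv(2) Cons.hyps(1) by (subst tied_class_mult) auto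
      finally show ?thesis
        using l' lv(2) 2 by (intro bexI[of _ ?l] bexI[of _ "b # v"]) auto
    qed
  qed
  then show ?thesis using that by blast
qed

text \<open>The pairs absorbed by \<open>ties l\<close> form an equivalence relation, so they include every pair of
  strands that the ties of \<open>l\<close> connect.\<close>

definition absorbs :: "(nat \<times> nat) list \<Rightarrow> nat rel" where
  "absorbs l = {(a, b) \<in> {1..n} \<times> {1..n}. ties l \<otimes>\<^bsub>T\<^esub> tie a b = ties l}"

text \<open>Reflexivity and symmetry come from the conventions for \<open>tie\<close>. For
  transitivity, \<open>ties l\<close> absorbs \<open>tie a b\<close> and \<open>tie b d\<close>,
  hence by the triangle identity the product of \<open>tie b d\<close> and \<open>tie a d\<close>; a
  further \<open>tie a d\<close> is then swallowed by idempotence.\<close>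

lemma equiv_absorbs:
  assumes l: "l \<in> pairs"
  shows "equiv {1..n} (absorbs l)"
proof (rule equivI)
  show "absorbs l \<subseteq> {1..n} \<times> {1..n}" by (auto simp: absorbs_def)
  show "refl_on {1..n} (absorbs l)"
    using ties_closed[OF l] by (auto simp: refl_on_def absorbs_def)
  show "sym (absorbs l)"
    using tie_commute by (auto simp: sym_def absorbs_def)
  show "trans (absorbs l)"
  proof (rule transI)
    fix a b d assume ab: "(a, b) \<in> absorbs l" and bd: "(b, d) \<in> absorbs l"
    then have A: "a \<in> {1..n}" "b \<in> {1..n}" "d \<in> {1..n}"
      and E: "ties l \<otimes>\<^bsub>T\<^esub> tie a b = ties l" "ties l \<otimes>\<^bsub>T\<^esub> tie b d = ties l"
      unfolding absorbs_def by blast+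
    note c = tie_closed[OF A(1,2)] tie_closed[OF A(2,3)] tie_closed[OF A(1,3)] ties_closed[OF l]
    show "(a, d) \<in> absorbs l"
    \<comment> \<open>The triangle identity requires three distinct strands. When two coincide, the
      claim is one of the hypotheses or reflexivity.\<close>
    proof (cases "distinct [a, b, d]")
      case True
      have "ties l = ties l \<otimes>\<^bsub>T\<^esub> (tie a b \<otimes>\<^bsub>T\<^esub> tie b d)"
        using c E by (simp flip: T.m_assoc)
      then have 1: "ties l = ties l \<otimes>\<^bsub>T\<^esub> (tie b d \<otimes>\<^bsub>T\<^esub> tie a d)"
        using tie_triangle(1)[OF A True] by simp
      have "ties l \<otimes>\<^bsub>T\<^esub> tie a d = ties l \<otimes>\<^bsub>T\<^esub> (tie b d \<otimes>\<^bsub>T\<^esub> tie a d) \<otimes>\<^bsub>T\<^esub> tie a d"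
        using 1 by simp
      also have "\<dots> = ties l \<otimes>\<^bsub>T\<^esub> (tie b d \<otimes>\<^bsub>T\<^esub> (tie a d \<otimes>\<^bsub>T\<^esub> tie a d))"
        using c by (simp add: T.m_assoc)
      also have "\<dots> = ties l" using 1 tie_idem[OF A(1,3)] by simp
      finally show ?thesis using A by (simp add: absorbs_def)
    next
      case False
      then consider "a = b" | "b = d" | "a = d" by auto
      then show ?thesis
      proof cases
        case 3
        then show ?thesis using A c(4) by (simp add: absorbs_def)
      qed (use ab bd in simp_all)
    qed
  qed
qed

text \<open>A second copy of the head tie commutes past \<open>ties l\<close> to meet the first, and
  idempotence removes it; pairs absorbed by the tail stay absorbed.\<close>

lemma absorbs_members:
  assumes "l \<in> pairs"
  shows "set l \<subseteq> absorbs l"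
  using assms
proof (induction l)
  case (Cons p l)
  obtain a b where p: "p = (a, b)" "a \<in> {1..n}" "b \<in> {1..n}" using Cons.hyps by auto
  have l: "l \<in> pairs" using Cons by simp
  note c = tie_closed[OF p(2,3)] ties_closed[OF l]
  have "ties (p # l) \<otimes>\<^bsub>T\<^esub> tie a b = tie a b \<otimes>\<^bsub>T\<^esub> (ties l \<otimes>\<^bsub>T\<^esub> tie a b)"
    using c by (simp add: p T.m_assoc)
  also have "\<dots> = tie a b \<otimes>\<^bsub>T\<^esub> tie a b \<otimes>\<^bsub>T\<^esub> ties l"
    using c by (simp add: T.m_assoc flip: tie_ties_commute[OF l p(2,3)])
  finally have "(a, b) \<in> absorbs (p # l)" using p tie_idem[OF p(2,3)] by (simp add: absorbs_def)
  moreover have "absorbs l \<subseteq> absorbs (p # l)"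
  proof
    fix q assume q: "q \<in> absorbs l"
    then obtain d e where de: "q = (d, e)" "d \<in> {1..n}" "e \<in> {1..n}" "ties l \<otimes>\<^bsub>T\<^esub> tie d e = ties l"
      by (auto simp: absorbs_def)
    then show "q \<in> absorbs (p # l)"
      using c tie_closed[OF de(2,3)] by (simp add: absorbs_def p T.m_assoc)
  qed
  ultimately show ?case using Cons.IH p by auto
qed simp

lemma ties_absorb:
  assumes l: "l \<in> pairs" and l': "l' \<in> pairs" "set l' \<subseteq> absorbs l"
  shows "ties l \<otimes>\<^bsub>T\<^esub> ties l' = ties l"
  using l'
proof (induction l')
  case Nil
  then show ?case using l by simp
next
  case (Cons p l')
  obtain a b where p: "p = (a, b)" "a \<in> {1..n}" "b \<in> {1..n}" using Cons.hyps by auto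
  have E: "ties l \<otimes>\<^bsub>T\<^esub> tie a b = ties l" using Cons.prems p by (auto simp: absorbs_def)
  have "ties l \<otimes>\<^bsub>T\<^esub> ties (p # l') = ties l \<otimes>\<^bsub>T\<^esub> tie a b \<otimes>\<^bsub>T\<^esub> ties l'"
    using l Cons.hyps tie_closed[OF p(2,3)] by (simp add: p T.m_assoc)
  then show ?case using E Cons by simp
qed

subsection \<open>The isomorphism\<close>

context
  notes One_nat_def [simp del]
begin

abbreviation bcl where "bcl \<equiv> pres_class (braid_gens n) (braid_rel n)"
abbreviation mu where "mu \<equiv> tie_partition {1..n}"
abbreviation J where "J \<equiv> partition_join {1..n}"
abbreviation singles where "singles \<equiv> (\<lambda>i. {i}) ` {1..n}"

section \<open>The braid and the partition of a tied word\<close>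

text \<open>\<open>strip\<close> and \<open>tied_partition\<close> are the components of a product
  in the semidirect product, where \<open>Eta i\<close> stands for a tie with the trivial braid.
  They are defined on words first; invariance under the relations follows below.\<close>

primrec strip :: "tied_gen list \<Rightarrow> braid_gen list" where
  "strip [] = []"
| "strip (g # w) = (case g of Braid b \<Rightarrow> b # strip w | Eta i \<Rightarrow> strip w)"

primrec tied_partition :: "tied_gen list \<Rightarrow> nat set set" where
  "tied_partition [] = singles"
| "tied_partition (g # w) = (case g of Braid b \<Rightarrow> partition_act (gen_perm b) (tied_partition w)
    | Eta i \<Rightarrow> J (mu i (i+1)) (tied_partition w))"

lemma strip_append [simp]: "strip (u @ v) = strip u @ strip v"
  by (induction u) (auto split: tied_gen.split)

lemma strip_map_Braid [simp]: "strip (map Braid w) = w"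
  by (induction w) auto

lemma tied_gens_cases:
  assumes "g \<in> tied_gens n"
  obtains b where "b \<in> braid_gens n" "g = Braid b" | i where "i \<in> {1..<n}" "g = Eta i"
  using assms unfolding tied_gens_def by blast

lemma gen_perm_permutes: "b \<in> braid_gens n \<Longrightarrow> gen_perm b permutes {1..n}"
  using word_perm_permutes[of "[b]" n] by simp

lemma partition_on_mu: "i \<in> {1..<n} \<Longrightarrow> partition_on {1..n} (mu i (i+1))"
  by (intro partition_on_tie_partition) auto

lemma strip_words: "w \<in> lists (tied_gens n) \<Longrightarrow> strip w \<in> lists (braid_gens n)"
  by (induction w) (auto elim!: tied_gens_cases)

lemma partition_on_tied_partition:
  "w \<in> lists (tied_gens n) \<Longrightarrow> partition_on {1..n} (tied_partition w)"
proof (induction w)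
  case (Cons g w)
  have w: "partition_on {1..n} (tied_partition w)" using Cons by simp
  from Cons.prems have "g \<in> tied_gens n" by simp
  then show ?case
  proof (cases rule: tied_gens_cases)
    case (1 b)
    then show ?thesis using partition_on_partition_act[OF gen_perm_permutes w] by simp
  next
    case (2 i)
    then show ?thesis using partition_on_join[OF partition_on_mu w] by simp
  qed
qed (simp add: partition_on_singletons)

text \<open>Together with \<open>strip_append\<close> this is the multiplication law of the
  semidirect product.\<close>

lemma tied_partition_append:
  assumes "u \<in> lists (tied_gens n)" and v: "v \<in> lists (tied_gens n)"
  shows "tied_partition (u @ v)
    = J (tied_partition u) (partition_act (word_perm (strip u)) (tied_partition v))"
  using assms(1)
proof (induction u)
  case Nil
  then show ?case using partition_on_tied_partition[OF v] partition_act_id[of "tied_partition v"]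
    by (simp add: partition_join_singletons id_def)
next
  case (Cons g u)
  have u: "u \<in> lists (tied_gens n)" using Cons by simp
  note P = partition_on_tied_partition[OF u]
    partition_on_partition_act[OF word_perm_permutes[OF strip_words[OF u]] partition_on_tied_partition[OF v]]
  from Cons.hyps(1) show ?case
  proof (cases rule: tied_gens_cases)
    case (1 b)
    then show ?thesis
      using Cons.IH partition_act_join[OF gen_perm_permutes[OF 1(1)] P]
      by (simp add: partition_act_comp[unfolded comp_def] comp_def)
  next
    case (2 i)
    then show ?thesis
      using Cons.IH partition_join_assoc[OF partition_on_mu[OF 2(1)] P] by simp
  qed
qed

lemma tied_partition_map_Braid:
  "w \<in> lists (braid_gens n) \<Longrightarrow> tied_partition (map Braid w) = singles"
  by (induction w) (auto simp: partition_act_singletons gen_perm_permutes)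

lemma partition_act_mu:
  "i \<in> {1..<n} \<Longrightarrow> partition_act (transpose i (i+1)) (mu a b) = mu (transpose i (i+1) a) (transpose i (i+1) b)"
  by (intro partition_act_tie_partition permutes_swap_id) auto

text \<open>The two adjacent pairs cover three consecutive strands, and \<open>\<nu>\<close> ties
  the outer two. Any two sides of this triangle have the same join, which is what the relations with
  two ties and one \<sigma>_i demand.\<close>

lemma partition_join_adjacent_mu:
  assumes ij: "i \<in> {1..<n}" "j \<in> {1..<n}" "\<bar>int i - int j\<bar> = 1"
  defines "\<nu> \<equiv> partition_act (transpose i (i+1)) (mu j (j+1))"
  shows "J (mu i (i+1)) (mu j (j+1)) = J (mu j (j+1)) \<nu>"
    and "J (mu j (j+1)) \<nu> = J (mu i (i+1)) \<nu>"
proof -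
  consider "j = i + 1" | "i = j + 1" using ij(3) by linarith
  then have "J (mu i (i+1)) (mu j (j+1)) = J (mu j (j+1)) \<nu> \<and> J (mu j (j+1)) \<nu> = J (mu i (i+1)) \<nu>"
  proof cases
    case 1
    have A: "i \<in> {1..n}" "i+1 \<in> {1..n}" "i+1+1 \<in> {1..n}" using ij 1 by auto
    have n: "\<nu> = mu i (i+1+1)" and m: "mu j (j+1) = mu (i+1) (i+1+1)"
      using 1 partition_act_mu[OF ij(1)] by (simp_all add: \<nu>_def transpose_def)
    show ?thesis
      using tie_partition_join_triangle[OF A] tie_partition_join_triangle[OF A(2,1,3)]
        tie_partition_commute[of _ i "i+1"] partition_join_commute[of _ "mu i (i+1+1)" "mu (i+1) (i+1+1)"]
      unfolding n m by metis
  next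
    case 2
    have A: "j \<in> {1..n}" "j+1 \<in> {1..n}" "j+1+1 \<in> {1..n}" using ij 2 by auto
    have n: "\<nu> = mu j (j+1+1)" and m: "mu i (i+1) = mu (j+1) (j+1+1)"
      using 2 partition_act_mu[OF ij(1)] by (simp_all add: \<nu>_def transpose_def)
    show ?thesis
      using tie_partition_join_triangle[OF A(3,2,1)] tie_partition_join_triangle[OF A(2,3,1)]
        tie_partition_commute[of _ j "j+1"] tie_partition_commute[of _ j "j+1+1"]
        tie_partition_commute[of _ "j+1" "j+1+1"]
        partition_join_commute[of _ "mu j (j+1+1)" "mu j (j+1)"]
      unfolding n m by metis
  qed
  then show "J (mu i (i+1)) (mu j (j+1)) = J (mu j (j+1)) \<nu>" "J (mu j (j+1)) \<nu> = J (mu i (i+1)) \<nu>"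
    by blast+
qed

lemma tied_rel_partition:
  assumes "tied_rel n u v"
  shows "tied_partition u = tied_partition v"
  using assms
proof cases
  case (braid u' v')
  then show ?thesis using braid.rel_words[of n u' v'] tied_partition_map_Braid by simp
next
  case (eta_comm i j)
  then show ?thesis
    using partition_on_mu[of i] partition_on_mu[of j] partition_join_commute[of "{1..n}" "mu i (i+1)" "mu j (j+1)"]
    by (simp add: partition_join_singletons del: atLeastLessThan_iff)
next
  case (eta_sigma i)
  have t: "transpose i (i+1) permutes {1..n}" using eta_sigma by (intro permutes_swap_id) auto
  show ?thesis
    using eta_sigma partition_on_mu[of i] partition_act_mu[of i i "i+1"] tie_partition_commute[of _ i "i+1"]
    by (simp add: partition_join_singletons partition_act_singletons[OF t] del: atLeastLessThan_iff)
next
  case (eta_sigma_far i j)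
  have t: "transpose j (j+1) permutes {1..n}" using eta_sigma_far by (intro permutes_swap_id) auto
  have "transpose j (j+1) i = i" "transpose j (j+1) (i+1) = i+1"
    using eta_sigma_far by (auto simp: transpose_def)
  then show ?thesis
    using eta_sigma_far partition_on_mu[of i] partition_act_mu[of j i "i+1"]
    by (simp add: partition_join_singletons partition_act_singletons[OF t] del: atLeastLessThan_iff)
next
  case (slide i j)
  have t: "transpose j (j+1) permutes {1..n}" "transpose i (i+1) permutes {1..n}"
    using slide by (auto intro!: permutes_swap_id)
  \<comment> \<open>The permutation of \<sigma>_j \<sigma>_i carries the pair \<open>j, j+1\<close>
    to \<open>i, i+1\<close>, so the tie emerges on the left as \<eta>_i.\<close>
  have "mu (transpose j (j+1) (transpose i (i+1) j)) (transpose j (j+1) (transpose i (i+1) (j+1))) = mu i (i+1)"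
    using slide(5) tie_partition_commute[of _ i "i+1"] by (auto simp: transpose_def abs_if split: if_splits)
  then show ?thesis
    using slide partition_on_mu[of i] partition_on_mu[of j] partition_act_mu[of i] partition_act_mu[of j]
    by (simp add: partition_join_singletons partition_act_singletons[OF t(1)]
        partition_act_singletons[OF t(2)] del: atLeastLessThan_iff)
next
  case (slide_inv i j)
  have t: "transpose j (j+1) permutes {1..n}" "transpose i (i+1) permutes {1..n}"
    using slide_inv by (auto intro!: permutes_swap_id)
  \<comment> \<open>The inverse of \<sigma>_i has the same permutation as \<sigma>_i, so the pair
    moves as in \<open>slide\<close>.\<close>
  have "mu (transpose j (j+1) (transpose i (i+1) j)) (transpose j (j+1) (transpose i (i+1) (j+1))) = mu i (i+1)"
    using slide_inv(5) tie_partition_commute[of _ i "i+1"] by (auto simp: transpose_def abs_if split: if_splits)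
  then show ?thesis
    using slide_inv partition_on_mu[of i] partition_on_mu[of j] partition_act_mu[of i] partition_act_mu[of j]
    by (simp add: partition_join_singletons partition_act_singletons[OF t(1)]
        partition_act_singletons[OF t(2)] del: atLeastLessThan_iff)
next
  case (eta_idem i)
  then show ?thesis
    using partition_on_mu[of i] by (simp add: partition_join_singletons partition_join_idem del: atLeastLessThan_iff)
next
  case (eta_eta_sigma1 i j)
  have t: "transpose i (i+1) permutes {1..n}" using eta_eta_sigma1 by (intro permutes_swap_id) auto
  show ?thesis
    using eta_eta_sigma1 partition_join_adjacent_mu(1)[of i j] partition_on_mu[of j]
    by (simp add: partition_join_singletons partition_act_singletons[OF t] del: atLeastLessThan_iff)
next
  case (eta_eta_sigma2 i j)
  have t: "transpose i (i+1) permutes {1..n}" using eta_eta_sigma2 by (intro permutes_swap_id) auto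
  \<comment> \<open>The swap exchanges the two strands of this tie, so on the right-hand side it
    changes only the factor from \<eta>_j.\<close>
  have "partition_act (transpose i (i+1)) (mu i (i+1)) = mu i (i+1)"
    using eta_eta_sigma2 partition_act_mu[of i i "i+1"] tie_partition_commute[of _ i "i+1"] by simp
  then show ?thesis
    using eta_eta_sigma2 partition_join_adjacent_mu(2)[of i j] partition_on_mu[of i] partition_on_mu[of j]
    by (simp add: partition_join_singletons partition_act_join[OF t] del: atLeastLessThan_iff)
qed

text \<open>Outside the braid family, erasing the ties makes the two sides the same word.\<close>

lemma tied_rel_strip:
  assumes "tied_rel n u v"
  shows "pres_cong (braid_gens n) (braid_rel n) (strip u) (strip v)"
  using assms
proof cases
  case (braid u' v')
  then show ?thesis using pres_cong.rel[of "braid_rel n" u' v' "[]" "braid_gens n" "[]"] by simp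
qed (auto simp: braid_gens_def intro!: pres_cong.refl)

lemma tied_cong_invariants:
  "pres_cong (tied_gens n) (tied_rel n) u v \<Longrightarrow> tied_partition u = tied_partition v
    \<and> pres_cong (braid_gens n) (braid_rel n) (strip u) (strip v)"
proof (induction rule: pres_cong.induct)
  case (refl w)
  then show ?case using strip_words by (auto intro: pres_cong.refl)
next
  case (sym u v)
  then show ?case by (auto intro: pres_cong.sym)
next
  case (trans u v w)
  then show ?case by (auto intro: pres_cong.trans)
next
  case (rel u v x y)
  have uv: "u \<in> lists (tied_gens n)" "v \<in> lists (tied_gens n)" using tied.rel_words[OF rel(1)] by auto
  have c: "pres_cong (braid_gens n) (braid_rel n) (strip u) (strip v)"
    using rel(1) by (rule tied_rel_strip)
  \<comment> \<open>The partition of \<open>y\<close> enters through the permutation of the word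
    before it, so \<open>strip u\<close> and \<open>strip v\<close> must also have equal
    permutations.\<close>
  then have "tied_partition (u @ y) = tied_partition (v @ y)"
    using tied_rel_partition[OF rel(1)] word_perm_cong[OF c]
    by (simp add: tied_partition_append uv rel(3))
  then have "tied_partition (x @ u @ y) = tied_partition (x @ v @ y)"
    using rel uv by (simp add: tied_partition_append[of x])
  then show ?case
    using braid.pres_cong_context[OF c strip_words[OF rel(2)] strip_words[OF rel(3)]] by simp
qed

section \<open>The homomorphism to the semidirect product\<close>

text \<open>By \<open>tied_cong_invariants\<close> all words of a class give the same pair, so
  \<open>the_elem\<close> picks a well-defined value.\<close>

definition tied_iso :: "tied_gen list set \<Rightarrow> nat set set \<times> braid_gen list set" where
  "tied_iso X = the_elem ((\<lambda>w. (tied_partition w, bcl (strip w))) ` X)"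

lemma tied_iso_class:
  assumes "w \<in> lists (tied_gens n)"
  shows "tied_iso (tcl w) = (tied_partition w, bcl (strip w))"
proof -
  have "(tied_partition v, bcl (strip v)) = (tied_partition w, bcl (strip w))" if "v \<in> tcl w" for v
  proof -
    have "pres_cong (tied_gens n) (tied_rel n) w v" using that by (simp add: pres_class_def)
    then show ?thesis using tied_cong_invariants braid.pres_class_eqI by metis
  qed
  moreover have "w \<in> tcl w" using pres_cong.refl[OF assms] by (simp add: pres_class_def)
  ultimately have "(\<lambda>w. (tied_partition w, bcl (strip w))) ` tcl w = {(tied_partition w, bcl (strip w))}"
    by blast
  then show ?thesis by (simp add: tied_iso_def)
qed

abbreviation (input) PB where "PB \<equiv> partition_braid_monoid n"

lemma partition_braid_mult:
  assumes "u \<in> lists (braid_gens n)" "v \<in> lists (braid_gens n)"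
  shows "(I, bcl u) \<otimes>\<^bsub>PB\<^esub> (K, bcl v) = (J I (partition_act (word_perm u) K), bcl (u @ v))"
  using assms by (simp add: partition_braid_monoid_def set_partition_monoid_def braid_group_def
    braid_perm_class braid.pres_class_mult)

lemma partition_braid_carrier:
  "carrier PB = {I. partition_on {1..n} I} \<times> bcl ` lists (braid_gens n)"
  by (simp add: partition_braid_monoid_def set_partition_monoid_def braid_group_def braid.carrier_presented)

lemma tied_carrier: "carrier T = tcl ` lists (tied_gens n)"
  by (simp add: tied_braid_monoid_def tied.carrier_presented)

lemma tied_iso_hom: "tied_iso \<in> hom T PB"
proof (rule homI)
  fix x assume "x \<in> carrier T"
  then obtain w where w: "w \<in> lists (tied_gens n)" "x = tcl w" by (auto simp: tied_carrier)
  show "tied_iso x \<in> carrier PB"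
    using partition_on_tied_partition[OF w(1)] strip_words[OF w(1)]
    by (simp add: w tied_iso_class[OF w(1)] partition_braid_carrier)
next
  fix x y assume "x \<in> carrier T" "y \<in> carrier T"
  then obtain u v where uv: "u \<in> lists (tied_gens n)" "v \<in> lists (tied_gens n)" "x = tcl u" "y = tcl v"
    by (auto simp: tied_carrier)
  then show "tied_iso (x \<otimes>\<^bsub>T\<^esub> y) = tied_iso x \<otimes>\<^bsub>PB\<^esub> tied_iso y"
    by (simp add: tied_class_mult tied_iso_class partition_braid_mult strip_words tied_partition_append)
qed

lemma tied_iso_braid_of:
  "w \<in> lists (braid_gens n) \<Longrightarrow> tied_iso (braid_of w) = (singles, bcl w)"
  by (simp add: tied_iso_class tied_partition_map_Braid)

lemma tied_iso_eta:
  assumes "i \<in> {1..<n}"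
  shows "tied_iso (eta i) = (mu i (i+1), bcl [])"
  using assms partition_on_mu[OF assms]
  by (simp add: tied_iso_class partition_join_singletons del: atLeastLessThan_iff)

text \<open>No explicit word for the tie is needed. If a braid \<open>w\<close> carries strands 1, 2
  to \<open>a\<close>, \<open>b\<close>, then \<open>tie a b\<close> times \<open>braid_of w\<close>
  equals \<open>braid_of w\<close> times \<open>eta 1\<close>; the homomorphism turns this into
  equations for both components.\<close>

lemma tied_iso_tie:
  assumes ab: "a \<in> {1..n}" "b \<in> {1..n}"
  shows "tied_iso (tie a b) = (mu a b, bcl [])"
proof (cases "a = b")
  case True
  have "tied_iso (tcl []) = (singles, bcl [])"
    using tied_iso_class[of "[]"] by simp
  then show ?thesis
    using True ab tie_partition_same[of a "{1..n}"] by (simp add: tied_class_Nil)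
next
  case False
  then have 1: "1 \<in> {1..<n}" and 12: "1 \<in> {1..n}" "Suc 1 \<in> {1..n}" using ab by auto
  have "\<exists>w \<in> lists (braid_gens n). map (word_perm w) [1, Suc 1] = [a, b]"
    by (rule braid_word_transitive) (use ab False 12 in simp_all)
  then obtain w where w: "w \<in> lists (braid_gens n)" "map (word_perm w) [1, Suc 1] = [a, b]"
    by (elim bexE)
  note p = word_perm_permutes[OF w(1)] and u = braid_of_unit[OF w(1)]
  obtain t where t: "t \<in> lists (tied_gens n)" "tie a b = tcl t"
    using tie_closed[OF ab] by (auto simp: tied_carrier)
  note P = partition_on_tied_partition[OF t(1)] strip_words[OF t(1)]
  have e: "eta 1 \<in> carrier T" "braid_of w \<in> carrier T" "tie a b \<in> carrier T"
    using eta_closed[OF 1] u T.Units_closed tie_closed[OF ab] by auto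
  have "T.conjugate_by (braid_of w) (eta 1) = tie a b"
    using conjugate_braid_of_tie[OF w(1) 12] tie_adjacent[of 1] w(2) by simp
  then have "tie a b \<otimes>\<^bsub>T\<^esub> braid_of w = braid_of w \<otimes>\<^bsub>T\<^esub> eta 1"
    using T.conjugate_by_commute[OF u e(1)] by simp
  then have "tied_iso (tie a b) \<otimes>\<^bsub>PB\<^esub> tied_iso (braid_of w) = tied_iso (braid_of w) \<otimes>\<^bsub>PB\<^esub> tied_iso (eta 1)"
    using hom_mult[OF tied_iso_hom e(3,2)] hom_mult[OF tied_iso_hom e(2,1)] by simp
  then have *: "J (tied_partition t) (partition_act (word_perm (strip t)) singles)
      = J singles (partition_act (word_perm w) (mu 1 (Suc 1)))" "bcl (strip t @ w) = bcl w"
    using w(1) P by (simp_all add: t tied_iso_class tied_partition_map_Braid tied_iso_eta[OF 1] partition_braid_mult)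
  interpret B: group "braid_group n" by (rule group_braid_group)
  have "tied_partition t = mu a b"
    using *(1) w(2) partition_act_tie_partition[OF p, of 1 "Suc 1"] P(1)
      partition_on_tie_partition[OF ab]
    by (simp add: partition_act_singletons[OF word_perm_permutes[OF P(2)]] partition_join_singletons)
  \<comment> \<open>The second components agree after multiplication by the braid of
    \<open>w\<close>, which cancels in the braid group.\<close>
  moreover have "bcl (strip t) = bcl []"
  proof -
    have c: "bcl v \<in> carrier (braid_group n)" if "v \<in> lists (braid_gens n)" for v
      using that by (simp add: braid_group_def braid.carrier_presented)
    have "bcl (strip t) \<otimes>\<^bsub>braid_group n\<^esub> bcl w = bcl [] \<otimes>\<^bsub>braid_group n\<^esub> bcl w"
      using *(2) P(2) w(1) by (simp add: braid_group_def braid.pres_class_mult)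
    then show ?thesis using B.right_cancel[OF c[OF w(1)] c[OF P(2)] c[of "[]"]] by simp
  qed
  ultimately show ?thesis by (simp add: t tied_iso_class[OF t(1)])
qed

section \<open>Values on normal forms\<close>

fun ties_partition :: "(nat \<times> nat) list \<Rightarrow> nat set set" where
  "ties_partition [] = singles"
| "ties_partition ((a, b) # l) = J (mu a b) (ties_partition l)"

lemma partition_on_ties_partition: "l \<in> pairs \<Longrightarrow> partition_on {1..n} (ties_partition l)"
  by (induction l) (auto intro!: partition_on_singletons partition_on_join partition_on_tie_partition)

text \<open>Identifies \<open>ties_partition l\<close> as the partition generated by the pairs of
  \<open>l\<close>, in a form that can be compared with the quotient by
  \<open>absorbs\<close>.\<close>

lemma ties_partition_le_iff:
  assumes "l \<in> pairs" and L: "partition_on {1..n} L"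
  shows "ties_partition l \<preceq> L \<longleftrightarrow> (\<forall>(a, b)\<in>set l. same_block L a b)"
  using assms(1)
proof (induction l)
  case Nil
  then show ?case using singletons_le[OF L] by simp
next
  case (Cons p l)
  obtain a b where p: "p = (a, b)" "a \<in> {1..n}" "b \<in> {1..n}" using Cons.hyps by auto
  show ?case
    using Cons p partition_join_le_iff[OF partition_on_tie_partition[OF p(2,3)] partition_on_ties_partition L]
      tie_partition_le_iff[OF p(2,3) L] by simp
qed

lemma tied_iso_ties:
  assumes "l \<in> pairs"
  shows "tied_iso (ties l) = (ties_partition l, bcl [])"
  using assms
proof (induction l)
  case Nil
  show ?case using tied_iso_class[of "[]"] by (simp add: tied_class_Nil)
next
  case (Cons p l)
  obtain a b where p: "p = (a, b)" "a \<in> {1..n}" "b \<in> {1..n}" using Cons.hyps by auto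
  have "tied_iso (ties (p # l)) = tied_iso (tie a b) \<otimes>\<^bsub>PB\<^esub> tied_iso (ties l)"
    using hom_mult[OF tied_iso_hom tie_closed[OF p(2,3)] ties_closed] Cons.hyps p by simp
  then show ?case
    using Cons.IH tied_iso_tie[OF p(2,3)] partition_braid_mult[of "[]" "[]"] p by simp
qed

lemma tied_iso_normal_form:
  assumes "l \<in> pairs" "v \<in> lists (braid_gens n)"
  shows "tied_iso (ties l \<otimes>\<^bsub>T\<^esub> braid_of v) = (ties_partition l, bcl v)"
proof -
  have "tied_iso (ties l \<otimes>\<^bsub>T\<^esub> braid_of v) = (ties_partition l, bcl []) \<otimes>\<^bsub>PB\<^esub> (singles, bcl v)"
    using hom_mult[OF tied_iso_hom ties_closed[OF assms(1)] tied_class_closed[OF map_Braid_words[OF assms(2)]]]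
      tied_iso_ties[OF assms(1)] tied_iso_braid_of[OF assms(2)] by simp
  then show ?thesis
    using partition_braid_mult[of "[]" v "ties_partition l" singles] assms(2)
      partition_join_singletons(1)[OF partition_on_ties_partition[OF assms(1)]] by simp
qed

section \<open>Injectivity and surjectivity\<close>

text \<open>The quotient of the strands by \<open>absorbs p\<close> relates all pairs of
  \<open>p\<close>, so it lies above the partition they generate. As \<open>q\<close> generates the
  same partition, all its pairs are absorbed, and \<open>ties p\<close> absorbs
  \<open>ties q\<close>. Exchanging the roles and commuting the products gives equality.\<close>

lemma ties_eqI:
  assumes l: "l \<in> pairs" and l': "l' \<in> pairs" and eq: "ties_partition l = ties_partition l'"
  shows "ties l = ties l'"
proof -
  have *: "ties p \<otimes>\<^bsub>T\<^esub> ties q = ties p"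
    if p: "p \<in> pairs" and q: "q \<in> pairs" and eq: "ties_partition p = ties_partition q" for p q
  proof (rule ties_absorb[OF p q])
    let ?L = "{1..n} // absorbs p"
    note E = equiv_absorbs[OF p]
    have L: "partition_on {1..n} ?L" by (rule partition_on_quotient[OF E])
    have same: "same_block ?L a b \<longleftrightarrow> (a, b) \<in> absorbs p" for a b
    proof
      assume "same_block ?L a b"
      then show "(a, b) \<in> absorbs p"
        unfolding same_block_def using E by (meson quotient_eq_iff)
    next
      assume ab: "(a, b) \<in> absorbs p"
      then have "a \<in> {1..n}" by (auto simp: absorbs_def)
      then have "absorbs p `` {a} \<in> ?L" "a \<in> absorbs p `` {a}" "b \<in> absorbs p `` {a}"
        using ab equiv_class_self[OF E] by (auto intro: quotientI)
      then show "same_block ?L a b" unfolding same_block_def by blast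
    qed
    have "ties_partition p \<preceq> ?L"
      using absorbs_members[OF p] by (auto simp: ties_partition_le_iff[OF p L] same)
    then show "set q \<subseteq> absorbs p"
      by (auto simp: eq ties_partition_le_iff[OF q L] same)
  qed
  show ?thesis
    using *[OF l l' eq] *[OF l' l eq[symmetric]] ties_commute[OF l l'] by simp
qed

lemma inj_on_tied_iso: "inj_on tied_iso (carrier T)"
proof (rule inj_onI)
  fix x y assume x: "x \<in> carrier T" and y: "y \<in> carrier T" and eq: "tied_iso x = tied_iso y"
  obtain l v where lv: "l \<in> pairs" "v \<in> lists (braid_gens n)" "x = ties l \<otimes>\<^bsub>T\<^esub> braid_of v"
    using x tied_normal_form unfolding tied_carrier by blast
  obtain l' v' where lv': "l' \<in> pairs" "v' \<in> lists (braid_gens n)" "y = ties l' \<otimes>\<^bsub>T\<^esub> braid_of v'"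
    using y tied_normal_form unfolding tied_carrier by blast
  have "ties_partition l = ties_partition l'" and b: "bcl v = bcl v'"
    using eq lv lv' tied_iso_normal_form by auto
  then have "ties l = ties l'" using ties_eqI lv(1) lv'(1) by blast
  \<comment> \<open>Equal braid classes make \<open>v\<close> and \<open>v'\<close> congruent, and
    the congruence persists among tied words.\<close>
  moreover have "braid_of v = braid_of v'"
    using b pres_cong.refl[OF lv'(2)] by (intro tied_class_braid_cong) (auto simp: pres_class_def)
  ultimately show "x = y" using lv(3) lv'(3) by simp
qed

lemma ex_ties_partition:
  assumes I: "partition_on {1..n} I"
  shows "\<exists>l\<in>pairs. ties_partition l = I"
proof -
  have I1: "{(a, b). same_block I a b} \<subseteq> {1..n} \<times> {1..n}"
    using partition_onD1[OF I] by (auto simp: same_block_def)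
  \<comment> \<open>There are finitely many related pairs, so one list holds them all; its generated
    partition has the same upper bounds as \<open>I\<close>.\<close>
  then obtain l where l: "set l = {(a, b). same_block I a b}"
    using finite_list[OF finite_subset[OF I1]] by auto
  then have p: "l \<in> pairs" using I1 by (auto simp: in_lists_conv_set)
  have "ties_partition l = I"
    by (rule partition_eqI_upper_bounds[OF partition_on_ties_partition[OF p] I])
      (auto simp: ties_partition_le_iff[OF p] partition_le_iff_same_block[OF I] l)
  then show ?thesis using p by blast
qed

lemma tied_iso_surj: "tied_iso ` carrier T = carrier PB"
proof
  show "tied_iso ` carrier T \<subseteq> carrier PB" using hom_in_carrier[OF tied_iso_hom] by blast
  show "carrier PB \<subseteq> tied_iso ` carrier T"
  proof
    fix x assume "x \<in> carrier PB"
    then obtain I v where x: "x = (I, bcl v)" "partition_on {1..n} I" "v \<in> lists (braid_gens n)"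
      by (auto simp: partition_braid_carrier)
    then obtain l where l: "l \<in> pairs" "ties_partition l = I" using ex_ties_partition by blast
    have "ties l \<otimes>\<^bsub>T\<^esub> braid_of v \<in> carrier T"
      using ties_closed[OF l(1)] tied_class_closed[OF map_Braid_words[OF x(3)]] by simp
    then show "x \<in> tied_iso ` carrier T"
      using tied_iso_normal_form[OF l(1) x(3)] x l by (metis imageI)
  qed
qed

end

end

theorem theorem3:
  fixes n :: nat
  shows "tied_braid_monoid n \<cong> partition_braid_monoid n"
proof (rule is_isoI)
  show "tied_iso n \<in> iso (tied_braid_monoid n) (partition_braid_monoid n)"
    unfolding iso_def bij_betw_def using tied_iso_hom inj_on_tied_iso tied_iso_surj by blast
qed

end
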